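(* Let $d\ge2$ be an integer, let $L\in\mathbb{N}_0$, and let $\phi\colon[0,\infty)\to[0,\infty)$ be a continuous function with $\phi(t)>0$ for $0\le t\le\frac12$ and $\phi(t)=0$ for $t\ge1$. For $\delta>0$ let $w(y,z)=\phi\big(d(y,z)/\delta\big)$, $y,z\in\mathbb{S}^{d-1}$, be the corresponding weight function. For every subspace $\mathcal{G}\subseteq\mathcal{H}_L(\mathbb{S}^{d-1})$ and every $c>0$ there exist constants $h_0,r,C(\phi,c)>0$ such that for arbitrary node sets $Y=\{y_1,\dots,y_N\}\subset\mathbb{S}^{d-1}$ with fill distance $h\le h_0$ and uniformity $h/q\le c$, where $q$ is the separation distance, and for $\delta=R\,h$ with $R\ge r$, the Lebesgue constant is uniformly bounded by $C(\phi,c)$: $$\mathcal{L}(\mathcal{G},w,Y,y)\le C(\phi,c)\qquad\text{for all }y\in\mathbb{S}^{d-1}.$$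
   Context: $\mathbb{S}^{d-1}=\{y\in\mathbb{R}^d : \|y\|_2=1\}$, with great circle distance $d(y,z)=\arccos(\langle y,z\rangle)$. All function spaces are linear over a fixed field $\mathbb{K}\in\{\mathbb{R},\mathbb{C}\}$ and consist of $\mathbb{K}$-valued functions. $\mathcal{H}_L(\mathbb{S}^{d-1})=\bigoplus_{\ell=0}^L\mathrm{Harm}_\ell(\mathbb{S}^{d-1})$, where $\mathrm{Harm}_\ell(\mathbb{S}^{d-1})=\{h|_{\mathbb{S}^{d-1}} : h\in\mathrm{Hom}_\ell(\mathbb{R}^d),\ \Delta_d h\equiv0\}$, $\mathrm{Hom}_\ell(\mathbb{R}^d)$ is the space of homogeneous polynomials of degree $\ell$ on $\mathbb{R}^d$ (including $0$) and $\Delta_d$ is the Laplacian. For distinct nodes $y_1,\dots,y_N\in\mathbb{S}^{d-1}$ ($N\ge2$) the fill distance is $h=\sup_{y\in\mathbb{S}^{d-1}}\min_i d(y_i,y)$ and the separation distance is $q=\frac12\min_{i\ne j}d(y_i,y_j)$. The Lebesgue constant with respect to the ansatz space $\mathcal{G}$, weight function $w$, nodes $Y$ and center $y$ is $\mathcal{L}(\mathcal{G},w,Y,y)=\sum_{w(y_i,y)>0}|a_i^*(y)|$, where the coefficients $a_i^*(y)\in\mathbb{K}$ are the unique solution of the problem of minimizing $\sum_{w(y_i,y)>0}\frac{1}{w(y_i,y)}|a_i(y)|^2$ over coefficients $a_i(y)\in\mathbb{K}$ subject to $\sum_{w(y_i,y)>0}a_i(y)\,g(y_i)=g(y)$ for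 all $g\in\mathcal{G}$. *)

theory Defs
  imports "HOL-Analysis.Analysis" "HOL-Library.Function_Algebras"
begin

(* The scalar field K of the paper, K = R or K = C.  A finite-dimensional commutative division
   algebra over R with a multiplicative norm is isometrically isomorphic to R or to C, so up to
   isomorphism the class has exactly the two instances below. *)
class real_or_complex = real_normed_field + euclidean_space

instance real :: real_or_complex ..
instance complex :: real_or_complex ..

definition Hom :: "nat \<Rightarrow> (real^'n \<Rightarrow> 'k::real_or_complex) set" where
  "Hom l = {p. \<exists>c. \<forall>x. p x =
     (\<Sum>\<alpha> | sum \<alpha> UNIV = l. c \<alpha> * of_real (\<Prod>i\<in>UNIV. (x $ i) ^ \<alpha> i))}"

definition partial_deriv :: "'n \<Rightarrow> (real^'n \<Rightarrow> 'k::real_or_complex) \<Rightarrow> real^'n \<Rightarrow> 'k" where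
  "partial_deriv i f x = vector_derivative (\<lambda>t. f (x + t *\<^sub>R axis i 1)) (at 0)"

definition laplacian :: "(real^'n \<Rightarrow> 'k::real_or_complex) \<Rightarrow> real^'n \<Rightarrow> 'k" where
  "laplacian f x = (\<Sum>i\<in>UNIV. partial_deriv i (partial_deriv i f) x)"

(* Functions on the unit sphere are encoded as functions on R^d that vanish off the sphere, so that
   pointwise operations turn them into a K-vector space. *)
definition on_sphere :: "(real^'n \<Rightarrow> 'k::real_or_complex) \<Rightarrow> real^'n \<Rightarrow> 'k" where
  "on_sphere p x = (if x \<in> sphere 0 1 then p x else 0)"

definition Harm :: "nat \<Rightarrow> (real^'n \<Rightarrow> 'k::real_or_complex) set" where
  "Harm l = {on_sphere p | p. p \<in> Hom l \<and> (\<forall>x. laplacian p x = 0)}"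

(* The underlying space of the (internal) direct sum of Harm 0, ..., Harm L. *)
definition sph_harmonics :: "nat \<Rightarrow> (real^'n \<Rightarrow> 'k::real_or_complex) set" where
  "sph_harmonics L = {(\<lambda>x. \<Sum>l\<le>L. f l x) | f. \<forall>l\<le>L. f l \<in> Harm l}"

definition fun_scale :: "'k::real_or_complex \<Rightarrow> (real^'n \<Rightarrow> 'k) \<Rightarrow> real^'n \<Rightarrow> 'k" where
  "fun_scale c f = (\<lambda>x. c * f x)"

lemma vector_space_fun_scale:
  "vector_space (fun_scale :: 'k::real_or_complex \<Rightarrow> (real^'n \<Rightarrow> 'k) \<Rightarrow> _)"
  by unfold_locales (auto simp: fun_scale_def fun_eq_iff algebra_simps)

definition gc_dist :: "real^'n \<Rightarrow> real^'n \<Rightarrow> real" where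
  "gc_dist y z = arccos (y \<bullet> z)"

definition fill_distance :: "(real^'n) set \<Rightarrow> real" where
  "fill_distance Y = (SUP y\<in>sphere 0 1. Min ((\<lambda>z. gc_dist z y) ` Y))"

definition separation_distance :: "(real^'n) set \<Rightarrow> real" where
  "separation_distance Y = 1/2 * Min {gc_dist y z | y z. y \<in> Y \<and> z \<in> Y \<and> y \<noteq> z}"

definition node_set :: "(real^'n) set \<Rightarrow> bool" where
  "node_set Y \<longleftrightarrow> finite Y \<and> card Y \<ge> 2 \<and> Y \<subseteq> sphere 0 1"

definition weight :: "(real \<Rightarrow> real) \<Rightarrow> real \<Rightarrow> real^'n \<Rightarrow> real^'n \<Rightarrow> real" where
  "weight \<phi> \<delta> y z = \<phi> (gc_dist y z / \<delta>)"

definition active :: "(real^'n \<Rightarrow> real^'n \<Rightarrow> real) \<Rightarrow> (real^'n) set \<Rightarrow> real^'n \<Rightarrow> (real^'n) set" where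
  "active w Y y = {z \<in> Y. w z y > 0}"

(* Coefficients are indexed by the nodes themselves.  Only active nodes carry a coefficient; setting
   the remaining values to 0 makes a coefficient family determined by its values there. *)
definition admissible ::
  "(real^'n \<Rightarrow> 'k::real_or_complex) set \<Rightarrow> (real^'n \<Rightarrow> real^'n \<Rightarrow> real) \<Rightarrow> (real^'n) set \<Rightarrow> real^'n
     \<Rightarrow> (real^'n \<Rightarrow> 'k) \<Rightarrow> bool" where
  "admissible G w Y y a \<longleftrightarrow>
     (\<forall>z. z \<notin> active w Y y \<longrightarrow> a z = 0) \<and>
     (\<forall>g\<in>G. (\<Sum>z\<in>active w Y y. a z * g z) = g y)"

definition objective ::
  "(real^'n \<Rightarrow> real^'n \<Rightarrow> real) \<Rightarrow> (real^'n) set \<Rightarrow> real^'n \<Rightarrow> (real^'n \<Rightarrow> 'k::real_or_complex) \<Rightarrow> real" where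
  "objective w Y y a = (\<Sum>z\<in>active w Y y. 1 / w z y * (norm (a z))\<^sup>2)"

definition is_minimizer ::
  "(real^'n \<Rightarrow> 'k::real_or_complex) set \<Rightarrow> (real^'n \<Rightarrow> real^'n \<Rightarrow> real) \<Rightarrow> (real^'n) set \<Rightarrow> real^'n
     \<Rightarrow> (real^'n \<Rightarrow> 'k) \<Rightarrow> bool" where
  "is_minimizer G w Y y a \<longleftrightarrow> admissible G w Y y a \<and>
     (\<forall>b. admissible G w Y y b \<longrightarrow> objective w Y y a \<le> objective w Y y b)"

(* Meaningful only if there is exactly one minimizer, that is, if the constraints can be satisfied. *)
definition lebesgue_constant ::
  "(real^'n \<Rightarrow> 'k::real_or_complex) set \<Rightarrow> (real^'n \<Rightarrow> real^'n \<Rightarrow> real) \<Rightarrow> (real^'n) set \<Rightarrow> real^'n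
     \<Rightarrow> real" where
  "lebesgue_constant G w Y y =
     (\<Sum>z\<in>active w Y y. norm ((THE a. is_minimizer G w Y y a) z))"

end

theory Submission
  imports Defs
begin

text \<open>The minimizer is \<open>w\<close> times the conjugate of the Riesz representer \<open>f \<in> G\<close> of point evaluation at \<open>y\<close>
  with respect to the weighted discrete inner product, and its objective is at most \<open>B\<close> as soon as
  \<open>\<bar>g y\<bar>\<^sup>2 \<le> B * \<Sum> w \<bar>g\<bar>\<^sup>2\<close> on \<open>G\<close>. By Cauchy--Schwarz the Lebesgue constant is then at most the
  square root of \<open>B\<close> times the sum of the weights, so it suffices to have \<open>B\<close> of order \<open>1 / n\<close>, where
  \<open>n\<close> is the number of active nodes.

  In stereographic coordinates centred at \<open>y\<close>, spherical harmonics become polynomials up to a harmless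
  factor, and a one-dimensional Markov inequality along segments through a maximum point yields a
  cap of radius comparable to \<open>\<delta>\<close> on which \<open>\<bar>g\<bar>\<close> is at least a fixed multiple of \<open>\<bar>g y\<bar>\<close>.
  Because the nodes are quasi-uniform, that cap contains a fixed proportion of the active nodes; this
  follows by comparing caps by rotations, without surface measure.\<close>

section \<open>Weighted least squares with linear constraints\<close>

text \<open>Gram-Schmidt, one coordinate at a time: the functions in \<open>F\<close> vanishing at
  the new index \<open>a\<close> fall under the induction hypothesis, and at most one further
  direction, orthogonal to them, remains. \<open>F\<close> may be infinite-dimensional; the last
  assumption says that \<open>\<Lambda>\<close> sees only the values on \<open>I\<close>.\<close>

lemma riesz_representation_finite:
  fixes F :: "('i \<Rightarrow> real) set" and w :: "'i \<Rightarrow> real" and \<Lambda> :: "('i \<Rightarrow> real) \<Rightarrow> real"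
  assumes "finite I" and "\<And>i. i \<in> I \<Longrightarrow> w i > 0"
    and "(\<lambda>_. 0) \<in> F"
    and "\<And>f g s. f \<in> F \<Longrightarrow> g \<in> F \<Longrightarrow> (\<lambda>i. f i + s * g i) \<in> F"
    and "\<And>f g s. f \<in> F \<Longrightarrow> g \<in> F \<Longrightarrow> \<Lambda> (\<lambda>i. f i + s * g i) = \<Lambda> f + s * \<Lambda> g"
    and "\<And>f. f \<in> F \<Longrightarrow> (\<And>i. i \<in> I \<Longrightarrow> f i = 0) \<Longrightarrow> \<Lambda> f = 0"
  shows "\<exists>f\<in>F. \<forall>g\<in>F. \<Lambda> g = (\<Sum>i\<in>I. w i * f i * g i)"
  using assms
proof (induction I arbitrary: F \<Lambda> rule: finite_induct)
  case empty
  then show ?case by auto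
next
  case (insert a I)
  note zero = insert.prems(2) and comb = insert.prems(3) and lin = insert.prems(4)
    and ker = insert.prems(5)
  define F0 where "F0 = {f \<in> F. f a = 0}"
  let ?ip = "\<lambda>f g. \<Sum>i\<in>I. w i * f i * g i"
  let ?ip' = "\<lambda>f g. \<Sum>i\<in>insert a I. w i * f i * g i"
  have ip': "?ip' f g = w a * f a * g a + ?ip f g" for f g
    using insert.hyps by simp
  have lin_ip: "?ip' f (\<lambda>i. g i + s * h i) = ?ip' f g + s * ?ip' f h" for f g h s
    by (simp only: sum_distrib_left sum.distrib[symmetric]) (simp add: algebra_simps)
  have lin_ip1: "?ip' (\<lambda>i. g i + s * h i) f = ?ip' g f + s * ?ip' h f" for f g h s
    by (simp only: sum_distrib_left sum.distrib[symmetric]) (simp add: algebra_simps)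
  \<comment> \<open>The induction hypothesis is prepared for a general functional because it is
    applied twice, to \<open>\<Lambda>\<close> and to the product with \<open>e\<close>.\<close>
  have rep: "\<exists>f\<in>F0. \<forall>g\<in>F0. \<Lambda>' g = ?ip f g"
    if "\<And>f g s. f \<in> F \<Longrightarrow> g \<in> F \<Longrightarrow> \<Lambda>' (\<lambda>i. f i + s * g i) = \<Lambda>' f + s * \<Lambda>' g"
      and "\<And>f. f \<in> F \<Longrightarrow> (\<And>i. i \<in> insert a I \<Longrightarrow> f i = 0) \<Longrightarrow> \<Lambda>' f = 0" for \<Lambda>'
  proof (rule insert.IH)
    show "\<Lambda>' f = 0" if "f \<in> F0" "\<And>i. i \<in> I \<Longrightarrow> f i = 0" for f
      using that \<open>\<And>f. f \<in> F \<Longrightarrow> (\<And>i. i \<in> insert a I \<Longrightarrow> f i = 0) \<Longrightarrow> \<Lambda>' f = 0\<close>[of f]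
      by (auto simp: F0_def)
  qed (use insert.prems(1) zero comb that(1) in \<open>auto simp: F0_def\<close>)
  obtain f0 where f0: "f0 \<in> F0" "\<And>g. g \<in> F0 \<Longrightarrow> \<Lambda> g = ?ip f0 g"
    using rep[of \<Lambda>] lin ker by blast
  show ?case
  proof (cases "\<exists>e\<in>F. e a \<noteq> 0")
    case False
    then have "F0 = F" by (auto simp: F0_def)
    with f0 show ?thesis by (intro bexI[of _ f0]) (auto simp: ip' F0_def)
  next
    case True
    then obtain e where e: "e \<in> F" "e a \<noteq> 0" by auto
    obtain p where p: "p \<in> F0" "\<And>g. g \<in> F0 \<Longrightarrow> ?ip' e g = ?ip p g"
      using rep[of "?ip' e"] lin_ip by auto
    \<comment> \<open>Since \<open>p\<close> represents the product with \<open>e\<close> on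
      \<open>F0\<close>, this difference is orthogonal to \<open>F0\<close>, while its value at
      \<open>a\<close> is still that of \<open>e\<close>.\<close>
    define e' where "e' = (\<lambda>i. e i + (-1) * p i)"
    have e'F: "e' \<in> F" unfolding e'_def using e p by (intro comb) (auto simp: F0_def)
    have e'a: "e' a = e a" using p by (simp add: e'_def F0_def)
    have orth: "?ip' e' g = 0" if "g \<in> F0" for g
    proof -
      have "?ip' e' g = ?ip' e g + (-1) * ?ip' p g" unfolding e'_def by (rule lin_ip1)
      moreover have "?ip' p g = ?ip p g" using that by (simp add: ip' F0_def)
      ultimately show ?thesis using p(2)[OF that] by linarith
    qed
    have pos: "?ip' e' e' > 0"
    proof -
      have "0 \<le> ?ip e' e'" using insert.prems(1)
        by (intro sum_nonneg) (simp add: mult.assoc less_imp_le)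
      moreover have "0 < w a * (e' a * e' a)"
      proof (rule mult_pos_pos)
        show "0 < e' a * e' a" using e(2) e'a by (metis not_real_square_gt_zero)
      qed (simp add: insert.prems(1))
      then have "0 < w a * e' a * e' a" by (simp only: mult.assoc)
      ultimately show ?thesis unfolding ip' by linarith
    qed
    \<comment> \<open>On \<open>F0\<close> the representer is \<open>f0\<close>; the multiple of
      \<open>e'\<close> is forced by the value of \<open>\<Lambda>\<close> at
      \<open>e'\<close>.\<close>
    define s where "s = \<Lambda> e' / ?ip' e' e'"
    define f where "f = (\<lambda>i. f0 i + s * e' i)"
    have fF: "f \<in> F" unfolding f_def using f0 e'F by (intro comb) (auto simp: F0_def)
    have "\<Lambda> g = ?ip' f g" if g: "g \<in> F" for g
    proof -
      \<comment> \<open>With this \<open>t\<close> the function \<open>g - t * e'\<close> vanishes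
        at \<open>a\<close>, which splits \<open>g\<close> into its part in \<open>F0\<close> and a
        multiple of \<open>e'\<close>.\<close>
      define t where "t = g a / e' a"
      define g0 where "g0 = (\<lambda>i. g i + (-t) * e' i)"
      have g0: "g0 \<in> F0"
        unfolding F0_def g0_def using comb[OF g e'F, of "-t"] e(2) by (auto simp: t_def e'a)
      have g_eq: "g = (\<lambda>i. g0 i + t * e' i)" by (auto simp: g0_def)
      have f0_e': "?ip' f0 e' = 0"
        using orth[OF f0(1)] by (simp add: mult.commute mult.left_commute)
      have "\<Lambda> g = \<Lambda> g0 + t * \<Lambda> e'"
        using lin[of g0 e' t] g0 e'F g_eq by (auto simp: F0_def)
      also have "\<Lambda> g0 = ?ip' f0 g0" using f0(2)[OF g0] g0 by (simp add: ip' F0_def)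
      also have "\<Lambda> e' = s * ?ip' e' e'" using pos by (simp add: s_def)
      finally have 1: "\<Lambda> g = ?ip' f0 g0 + t * (s * ?ip' e' e')" .
      have "?ip' f g = ?ip' f0 g + s * ?ip' e' g" unfolding f_def by (rule lin_ip1)
      also have "?ip' f0 g = ?ip' f0 g0 + t * ?ip' f0 e'" by (subst g_eq) (rule lin_ip)
      also have "?ip' e' g = ?ip' e' g0 + t * ?ip' e' e'" by (subst g_eq) (rule lin_ip)
      finally show ?thesis using 1 f0_e' orth[OF g0] by simp
    qed
    with fF show ?thesis by blast
  qed
qed

text \<open>Complex conjugation, expressed through the inner product so that it makes sense in the
  abstract class.\<close>
definition field_conj :: "'k::real_or_complex \<Rightarrow> 'k" where
  "field_conj r = adjoint ((*) r) 1"

lemma inner_field_conj: "field_conj r \<bullet> x = (r * x) \<bullet> (1::'k::real_or_complex)"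
proof -
  have "linear ((*) r)" by (rule bounded_linear.linear[OF bounded_linear_mult_right])
  from adjoint_works[OF this, of x 1] show ?thesis
    unfolding field_conj_def by (simp add: inner_commute)
qed

text \<open>Both inequalities are Cauchy-Schwarz combined with the multiplicative norm: pairing the
  conjugate with \<open>inverse r\<close> gives 1, and pairing it with itself gives the upper
  bound.\<close>

lemma norm_field_conj: "norm (field_conj r) = norm (r::'k::real_or_complex)"
proof (cases "r = 0")
  case True
  then show ?thesis using inner_field_conj[of r "field_conj r"] by simp
next
  case False
  have "1 = (1::'k) \<bullet> 1" by (metis norm_one power2_norm_eq_inner power_one)
  also have "\<dots> = field_conj r \<bullet> inverse r" using False by (simp add: inner_field_conj)
  also have "\<dots> \<le> norm (field_conj r) * norm (inverse r)" by (rule norm_cauchy_schwarz)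
  finally have 1: "norm r \<le> norm (field_conj r)" using False
    unfolding norm_inverse by (simp add: field_simps)
  have "(norm (field_conj r))\<^sup>2 = (r * field_conj r) \<bullet> 1"
    by (simp add: power2_norm_eq_inner inner_field_conj)
  also have "\<dots> \<le> norm (r * field_conj r)"
    using norm_cauchy_schwarz[of "r * field_conj r" 1] by simp
  finally have "norm (field_conj r) * norm (field_conj r) \<le> norm r * norm (field_conj r)"
    by (simp add: norm_mult power2_eq_square)
  moreover have "norm (field_conj r) > 0" using 1 False by (metis less_le_trans zero_less_norm_iff)
  ultimately show ?thesis using 1 by simp
qed

lemma field_conj_add: "field_conj (r + s) = field_conj r + field_conj (s::'k::real_or_complex)"
  by (rule vector_eq_rdot[THEN iffD1]) (simp add: inner_field_conj inner_add_left distrib_right)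

lemma inner_field_conj_field_conj: "field_conj r \<bullet> field_conj s = r \<bullet> (s::'k::real_or_complex)"
  by (simp add: dot_norm norm_field_conj field_conj_add[symmetric])

lemma inner_field_conj_swap: "field_conj r \<bullet> s = field_conj s \<bullet> (r::'k::real_or_complex)"
  by (simp add: inner_field_conj mult.commute)

text \<open>Follows from the isometry property and the symmetry of
  \<open>field_conj r \<bullet> s\<close>, without classifying the field as R or C.\<close>

lemma field_conj_field_conj: "field_conj (field_conj r) = (r::'k::real_or_complex)"
  by (rule vector_eq_rdot[THEN iffD1])
    (metis inner_field_conj_swap inner_field_conj_field_conj inner_commute)

text \<open>Lifts real identities to identities in the field: knowing the real part of every scalar
  multiple determines the element. The test scalar is the inverse of the difference.\<close>

lemma inner_mult_one_eqI:
  fixes u v :: "'k::real_or_complex"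
  assumes "\<And>m. (m * u) \<bullet> 1 = (m * v) \<bullet> 1"
  shows "u = v"
proof (rule ccontr)
  assume "u \<noteq> v"
  then have "(inverse (u - v) * (u - v)) \<bullet> (1::'k) = 1"
    by (metis left_inverse norm_one power2_norm_eq_inner power_one right_minus_eq)
  moreover have "(inverse (u - v) * (u - v)) \<bullet> (1::'k) = 0"
    using assms[of "inverse (u - v)"] by (simp add: right_diff_distrib inner_diff_left)
  ultimately show False by simp
qed

text \<open>Assumption \<open>B\<close> has two roles: evaluation at \<open>y\<close> vanishes on
  functions that vanish at all active nodes, as the Riesz lemma demands, and its instance at the
  representer bounds the objective.\<close>

lemma least_squares_minimizer:
  fixes G :: "(real^'n \<Rightarrow> 'k::real_or_complex) set"
  assumes G: "module.subspace fun_scale G"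
    and "finite Y" and "B \<ge> 0"
    and B: "\<And>g. g \<in> G \<Longrightarrow> (norm (g y))\<^sup>2 \<le> B * (\<Sum>z\<in>active w Y y. w z y * (norm (g z))\<^sup>2)"
  obtains a where "is_minimizer G w Y y a" "\<And>b. is_minimizer G w Y y b \<Longrightarrow> b = a"
    "objective w Y y a \<le> B"
proof -
  define A where "A = active w Y y"
  have finA: "finite A" using \<open>finite Y\<close> by (simp add: A_def active_def)
  have wpos: "w z y > 0" if "z \<in> A" for z using that by (simp add: A_def active_def)
  note module = module_iff_vector_space[THEN iffD2, OF vector_space_fun_scale]
  have zero: "(\<lambda>_. 0) \<in> G"
    using module.subspace_0[OF module G] by (simp add: zero_fun_def)
  have smult: "(\<lambda>x. m * g x) \<in> G" if "g \<in> G" for g m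
    using module.subspace_scale[OF module G that, of m] by (simp add: fun_scale_def)
  have comb: "(\<lambda>x. f x + s *\<^sub>R g x) \<in> G" if "f \<in> G" "g \<in> G" for f g s
    using module.subspace_add[OF module G that(1) smult[OF that(2), of "of_real s"]]
    by (simp add: plus_fun_def scaleR_conv_of_real)
  \<comment> \<open>Real coordinates of the values turn \<open>G\<close> into a real function space,
    so that the real Riesz lemma applies. The represented functional, read off at
    \<open>(y, 1)\<close>, is the real part of \<open>g y\<close>.\<close>
  define I where "I = A \<times> (Basis :: 'k set)"
  define coord :: "(real^'n \<Rightarrow> 'k) \<Rightarrow> (real^'n) \<times> 'k \<Rightarrow> real" where "coord g = (\<lambda>(z, b). g z \<bullet> b)" for g
  have coord_comb: "(\<lambda>i. coord f i + s * coord g i) = coord (\<lambda>x. f x + s *\<^sub>R g x)" for f g s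
    by (rule ext) (simp add: coord_def inner_add_left split: prod.split)
  have comb': "(\<lambda>i. p i + s * q i) \<in> coord ` G" if pq: "p \<in> coord ` G" "q \<in> coord ` G" for p q s
  proof -
    from pq obtain f g where f: "f \<in> G" "p = coord f" and g: "g \<in> G" "q = coord g" by blast
    show ?thesis unfolding f(2) g(2) coord_comb by (rule imageI[OF comb[OF f(1) g(1)]])
  qed
  have ker: "p (y, 1) = 0" if p: "p \<in> coord ` G" and 0: "\<And>i. i \<in> I \<Longrightarrow> p i = 0" for p
  proof -
    from p obtain g where g: "g \<in> G" "p = coord g" by blast
    have "g z = 0" if "z \<in> A" for z
    proof (rule euclidean_all_zero_iff[THEN iffD1, rule_format])
      fix b :: 'k
      assume "b \<in> Basis"
      with 0[of "(z, b)"] that show "g z \<bullet> b = 0" by (simp add: I_def coord_def g(2))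
    qed
    then have "(norm (g y))\<^sup>2 \<le> 0" using B[OF g(1)] by (simp add: A_def)
    then show ?thesis by (simp add: g(2) coord_def)
  qed
  have "\<exists>f\<in>coord ` G. \<forall>g\<in>coord ` G. g (y, 1) = (\<Sum>i\<in>I. w (fst i) y * f i * g i)"
  proof (rule riesz_representation_finite[where \<Lambda> = "\<lambda>g. g (y, 1)"])
    show "finite I" using finA by (simp add: I_def)
    show "w (fst i) y > 0" if "i \<in> I" for i using that wpos by (auto simp: I_def)
    show "(\<lambda>_. 0) \<in> coord ` G"
      by (rule image_eqI[OF _ zero]) (simp add: coord_def fun_eq_iff split: prod.split)
  qed (rule comb' ker refl; assumption)+
  then obtain f where f: "f \<in> G" and rep: "\<And>g. g \<in> G \<Longrightarrow>
      coord g (y, 1) = (\<Sum>i\<in>I. w (fst i) y * coord f i * coord g i)"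
    by auto
  have rep: "g y \<bullet> 1 = (\<Sum>z\<in>A. w z y * (f z \<bullet> g z))" if "g \<in> G" for g
  proof -
    have "(\<Sum>i\<in>I. w (fst i) y * coord f i * coord g i)
        = (\<Sum>z\<in>A. \<Sum>b\<in>Basis. w z y * (f z \<bullet> b) * (g z \<bullet> b))"
      by (simp add: I_def sum.cartesian_product coord_def case_prod_unfold)
    also have "\<dots> = (\<Sum>z\<in>A. w z y * (f z \<bullet> g z))"
      by (intro sum.cong refl)
        (simp add: euclidean_inner[of "f z" "g z" for z] sum_distrib_left mult.assoc)
    finally show ?thesis using rep[OF that] by (simp add: coord_def)
  qed
  define a where "a z = (if z \<in> A then w z y *\<^sub>R field_conj (f z) else 0)" for z
  \<comment> \<open>So far only the real part of \<open>g y\<close> is represented. As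
    \<open>G\<close> is closed under scalars of the field, \<open>m * g\<close> may replace
    \<open>g\<close>, which yields the full constraint.\<close>
  have adm: "(\<Sum>z\<in>A. a z * g z) = g y" if g: "g \<in> G" for g
  proof (rule inner_mult_one_eqI)
    fix m
    have "(m * (\<Sum>z\<in>A. a z * g z)) \<bullet> 1 = (\<Sum>z\<in>A. (a z * (m * g z)) \<bullet> 1)"
      by (simp add: sum_distrib_left inner_sum_left mult_ac)
    also have "\<dots> = (\<Sum>z\<in>A. w z y * (f z \<bullet> (m * g z)))"
      by (intro sum.cong refl) (simp add: a_def inner_field_conj[symmetric] field_conj_field_conj)
    also have "\<dots> = (m * g y) \<bullet> 1" using rep[OF smult[OF g, of m]] by simp
    finally show "(m * (\<Sum>z\<in>A. a z * g z)) \<bullet> 1 = (m * g y) \<bullet> 1" .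
  qed
  then have "admissible G w Y y a"
    by (auto simp: admissible_def A_def[symmetric] a_def)
  \<comment> \<open>The difference of two admissible families annihilates \<open>f\<close>, and
    \<open>a\<close> is the weighted conjugate of \<open>f\<close>; hence the difference is
    orthogonal to \<open>a\<close>. Minimality and uniqueness both follow.\<close>
  have pythagoras: "objective w Y y b = objective w Y y a + objective w Y y (\<lambda>z. b z - a z)"
    if b: "admissible G w Y y b" for b
  proof -
    have "(\<Sum>z\<in>A. (b z - a z) * f z) = f y - f y"
      using b f adm[OF f] by (simp add: admissible_def A_def[symmetric] left_diff_distrib sum_subtractf)
    then have "(\<Sum>z\<in>A. ((b z - a z) * f z) \<bullet> 1) = 0" by (simp add: inner_sum_left[symmetric])
    moreover have "1 / w z y * (a z \<bullet> (b z - a z)) = ((b z - a z) * f z) \<bullet> 1" if "z \<in> A" for z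
      using wpos[OF that] that by (simp add: a_def inner_field_conj mult.commute)
    ultimately have 0: "(\<Sum>z\<in>A. 1 / w z y * (a z \<bullet> (b z - a z))) = 0" by simp
    have "objective w Y y b = (\<Sum>z\<in>A. 1 / w z y * (norm (a z))\<^sup>2
        + (1 / w z y * (norm (b z - a z))\<^sup>2 + 2 * (1 / w z y * (a z \<bullet> (b z - a z)))))"
      unfolding objective_def A_def[symmetric]
    proof (intro sum.cong refl)
      fix z
      have *: "(norm (b z))\<^sup>2 = (norm (a z))\<^sup>2 + (norm (b z - a z))\<^sup>2 + 2 * (a z \<bullet> (b z - a z))"
        by (simp add: power2_norm_eq_inner inner_diff inner_commute)
      show "1 / w z y * (norm (b z))\<^sup>2 = 1 / w z y * (norm (a z))\<^sup>2
        + (1 / w z y * (norm (b z - a z))\<^sup>2 + 2 * (1 / w z y * (a z \<bullet> (b z - a z))))"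
        unfolding * by (simp add: algebra_simps)
    qed
    also have "\<dots> = objective w Y y a + objective w Y y (\<lambda>z. b z - a z)
        + 2 * (\<Sum>z\<in>A. 1 / w z y * (a z \<bullet> (b z - a z)))"
      by (simp add: objective_def A_def[symmetric] sum.distrib sum_distrib_left)
    finally show ?thesis using 0 by simp
  qed
  have obj_nonneg: "objective w Y y b \<ge> 0" for b :: "real^'n \<Rightarrow> 'k"
    unfolding objective_def A_def[symmetric] using wpos
    by (intro sum_nonneg) (simp add: less_imp_le)
  have "is_minimizer G w Y y a"
    unfolding is_minimizer_def
  proof (intro conjI allI impI)
    show "objective w Y y a \<le> objective w Y y b" if "admissible G w Y y b" for b
      using pythagoras[OF that] obj_nonneg[of "\<lambda>z. b z - a z"] by linarith
  qed fact
  moreover have "b = a" if b: "is_minimizer G w Y y b" for b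
  proof
    fix z
    have adm_b: "admissible G w Y y b" using b by (simp add: is_minimizer_def)
    have "objective w Y y b \<le> objective w Y y a"
      using b \<open>admissible G w Y y a\<close> by (simp add: is_minimizer_def)
    then have "objective w Y y (\<lambda>z. b z - a z) = 0"
      using pythagoras[OF adm_b] obj_nonneg[of "\<lambda>z. b z - a z"] by linarith
    then have "\<forall>z\<in>A. 1 / w z y * (norm (b z - a z))\<^sup>2 = 0"
      unfolding objective_def A_def[symmetric]
      using wpos by (subst (asm) sum_nonneg_eq_0_iff[OF finA]) (simp_all add: less_imp_le)
    then show "b z = a z"
      using adm_b wpos[of z] by (cases "z \<in> A") (auto simp: admissible_def A_def[symmetric] a_def)
  qed
  \<comment> \<open>The objective equals \<open>f y \<bullet> 1\<close>, so its square is at most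
    that of \<open>norm (f y)\<close>, which \<open>B\<close> at \<open>g = f\<close> bounds by
    \<open>B\<close> times the objective; one factor cancels.\<close>
  moreover have "objective w Y y a \<le> B"
  proof -
    have obj: "objective w Y y a = (\<Sum>z\<in>A. w z y * (norm (f z))\<^sup>2)"
      unfolding objective_def A_def[symmetric]
    proof (intro sum.cong refl)
      fix z
      assume "z \<in> A"
      then show "1 / w z y * (norm (a z))\<^sup>2 = w z y * (norm (f z))\<^sup>2"
        using wpos[of z] by (simp add: a_def norm_field_conj power2_eq_square)
    qed
    also have "\<dots> = f y \<bullet> 1" using rep[OF f] by (simp add: power2_norm_eq_inner)
    also have "\<dots> \<le> norm (f y)" using norm_cauchy_schwarz[of "f y" 1] by simp
    finally have "(objective w Y y a)\<^sup>2 \<le> (norm (f y))\<^sup>2" by (intro power_mono obj_nonneg)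
    also have "\<dots> \<le> B * objective w Y y a" using B[OF f] by (simp add: obj A_def)
    finally have le: "objective w Y y a * objective w Y y a \<le> B * objective w Y y a"
      by (simp add: power2_eq_square)
    show ?thesis
      using le obj_nonneg[of a] \<open>B \<ge> 0\<close> by (cases "objective w Y y a = 0") auto
  qed
  ultimately show thesis using that by blast
qed

section \<open>Distances and node counts on the sphere\<close>

text \<open>With \<open>u = t / 2\<close>, the bound \<open>u * cos u \<le> sin u\<close> and the
  double angle formula give \<open>sin t \<ge> t / 2 * (1 + cos t)\<close>. The constant is not
  sharp but suffices to compare arcs with chords.\<close>

lemma half_le_sin:
  fixes t :: real
  assumes "0 \<le> t" "t \<le> pi / 2"
  shows "t / 2 \<le> sin t"
proof -
  define u where "u = t / 2"
  have u: "0 \<le> u" "u \<le> pi / 4" using assms by (auto simp: u_def)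
  have "sin 0 - 0 * cos 0 \<le> sin u - u * cos u"
  proof (rule DERIV_nonneg_imp_nondecreasing[OF u(1)])
    fix x assume "0 \<le> x" "x \<le> u"
    then have "0 \<le> x * sin x" using u by (intro mult_nonneg_nonneg sin_ge_zero) auto
    moreover have "((\<lambda>x. sin x - x * cos x) has_real_derivative x * sin x) (at x)"
      by (auto intro!: derivative_eq_intros)
    ultimately show "\<exists>y. ((\<lambda>x. sin x - x * cos x) has_real_derivative y) (at x) \<and> 0 \<le> y"
      by blast
  qed
  then have "u * cos u \<le> sin u" by simp
  moreover have "0 \<le> cos u" using u by (intro cos_ge_zero) auto
  ultimately have "2 * (u * cos u) * cos u \<le> 2 * sin u * cos u" by (intro mult_right_mono) auto
  moreover have "2 * sin u * cos u = sin t" using sin_double[of u] by (simp add: u_def)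
  moreover have "2 * (u * cos u) * cos u = t / 2 * (1 + cos t)"
  proof -
    have "1 + cos t = 2 * (cos u * cos u)"
      using cos_double_cos[of u] by (simp add: u_def power2_eq_square)
    then show ?thesis by (simp only: u_def)
  qed
  moreover have "0 \<le> cos t" using assms by (intro cos_ge_zero) auto
  moreover have "t / 2 * 1 \<le> t / 2 * (1 + cos t)"
    using assms \<open>0 \<le> cos t\<close> by (intro mult_left_mono) auto
  ultimately show ?thesis by linarith
qed

text \<open>The chord is twice the sine of half the arc. These bounds allow Euclidean distances to
  replace great circle distances from here on.\<close>

lemma gc_dist_bounds:
  assumes "x \<in> sphere 0 1" "y \<in> sphere 0 1"
  shows "0 \<le> gc_dist x y" "gc_dist x y \<le> pi"
    and "dist x y \<le> gc_dist x y" "gc_dist x y \<le> 2 * dist x y"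
proof -
  have norms: "norm x = 1" "norm y = 1" using assms by auto
  then have ip: "- 1 \<le> x \<bullet> y" "x \<bullet> y \<le> 1"
    using Cauchy_Schwarz_ineq2[of x y] by auto
  define t where "t = gc_dist x y / 2"
  show *: "0 \<le> gc_dist x y" "gc_dist x y \<le> pi"
    using ip by (auto simp: gc_dist_def arccos_lbound arccos_ubound)
  then have t: "0 \<le> t" "t \<le> pi / 2" by (auto simp: t_def)
  then have sin_t: "0 \<le> sin t" by (intro sin_ge_zero) auto
  have "(dist x y)\<^sup>2 = 2 - 2 * (x \<bullet> y)"
    using norms by (simp add: dist_norm power2_norm_eq_inner inner_diff inner_commute norm_eq_1)
  also have "x \<bullet> y = cos (2 * t)" using ip by (simp add: t_def gc_dist_def)
  also have "2 - 2 * cos (2 * t) = (2 * sin t)\<^sup>2" by (simp add: cos_double_sin power_mult_distrib)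
  finally have "dist x y = 2 * sin t" 
    by (rule power2_eq_imp_eq) (use sin_t in simp_all)
  then show "dist x y \<le> gc_dist x y" "gc_dist x y \<le> 2 * dist x y"
    using sin_x_le_x[OF t(1)] half_le_sin[OF t] by (simp_all add: t_def)
qed

section \<open>Covering and packing numbers, and node counts in caps\<close>

text \<open>Total boundedness of the single ball \<open>cball 0 l\<close>, transported by
  translation and dilation, makes the number independent of \<open>p\<close> and
  \<open>e\<close>.\<close>

lemma cball_cover_bounded_card:
  fixes l :: real
  shows "\<exists>N. \<forall>p e. e > 0 \<longrightarrow>
    (\<exists>K. finite K \<and> card K \<le> N \<and> cball (p::'a::euclidean_space) (l * e) \<subseteq> (\<Union>x\<in>K. ball x e))"
proof -
  obtain k where k: "finite k" "cball (0::'a) l \<subseteq> (\<Union>x\<in>k. ball x 1)"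
    using compact_cball[of "0::'a" l] unfolding compact_eq_totally_bounded by (metis zero_less_one)
  show ?thesis
  proof (intro exI[of _ "card k"] allI impI)
    fix p :: 'a and e :: real assume e: "e > 0"
    show "\<exists>K. finite K \<and> card K \<le> card k \<and> cball p (l * e) \<subseteq> (\<Union>x\<in>K. ball x e)"
    proof (intro exI conjI subsetI)
      show "finite ((\<lambda>x. p + e *\<^sub>R x) ` k)" "card ((\<lambda>x. p + e *\<^sub>R x) ` k) \<le> card k"
        using k by (auto intro: card_image_le)
      fix z assume z: "z \<in> cball p (l * e)"
      define u where "u = (z - p) /\<^sub>R e"
      have "norm u = dist p z / e"
        using e by (simp add: u_def dist_norm norm_minus_commute divide_inverse mult.commute)
      then have "u \<in> cball 0 l" using z e by (simp add: pos_divide_le_eq)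
      with k obtain x where x: "x \<in> k" "dist x u < 1" by auto
      have "z = p + e *\<^sub>R u" using e by (simp add: u_def)
      then have "dist (p + e *\<^sub>R x) z = e * dist x u"
        using e by (simp add: dist_norm scaleR_diff_right[symmetric])
      also have "\<dots> < e" using x e by simp
      finally show "z \<in> (\<Union>x\<in>(\<lambda>x. p + e *\<^sub>R x) ` k. ball x e)" using x(1) by auto
    qed
  qed
qed

text \<open>Packing from covering: a ball of radius \<open>e / 2\<close> holds at most one point of
  an \<open>e\<close>-separated set. Halving the radius is why the covering number is taken for
  \<open>2 * l\<close>.\<close>

lemma separated_bounded_card:
  fixes l :: real
  shows "\<exists>N. \<forall>p e P. e > 0 \<longrightarrow> P \<subseteq> cball (p::'a::euclidean_space) (l * e) \<longrightarrow>
    (\<forall>x\<in>P. \<forall>y\<in>P. x \<noteq> y \<longrightarrow> e \<le> dist x y) \<longrightarrow> card P \<le> N"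
proof -
  obtain N where N: "\<And>p e. e > 0 \<Longrightarrow>
      \<exists>K. finite K \<and> card K \<le> N \<and> cball (p::'a) (2 * l * e) \<subseteq> (\<Union>x\<in>K. ball x e)"
    using cball_cover_bounded_card[of "2 * l"] by blast
  show ?thesis
  proof (intro exI[of _ N] allI impI)
    fix p :: 'a and e :: real and P
    assume e: "e > 0" and P: "P \<subseteq> cball p (l * e)" and sep: "\<forall>x\<in>P. \<forall>y\<in>P. x \<noteq> y \<longrightarrow> e \<le> dist x y"
    obtain K where K: "finite K" "card K \<le> N" "cball p (l * e) \<subseteq> (\<Union>x\<in>K. ball x (e / 2))"
      using N[of "e / 2" p] e by auto
    have "\<forall>x\<in>P. \<exists>k\<in>K. dist k x < e / 2" using P K(3) by (auto simp: subset_iff)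
    then obtain f where f: "\<And>x. x \<in> P \<Longrightarrow> f x \<in> K \<and> dist (f x) x < e / 2" by metis
    have "inj_on f P"
    proof (rule inj_onI, rule ccontr)
      fix x y assume xy: "x \<in> P" "y \<in> P" "f x = f y" "x \<noteq> y"
      have "dist x y \<le> dist (f x) x + dist (f x) y" by (rule dist_triangle3)
      also have "\<dots> < e" using f[OF xy(1)] f[OF xy(2)] xy(3) by simp
      finally show False using sep xy by force
    qed
    then have "card P \<le> card K" using f K(1) by (intro card_inj_on_le[of f]) auto
    then show "card P \<le> N" using K(2) by simp
  qed
qed

text \<open>Any two caps are related by a rotation. Mapping each rotated node of one cap to a nearest node
  yields a map whose fibres are bounded by the packing number of the ratio of \<open>h\<close> and \<open>q\<close>.\<close>
lemma card_nodes_rotated_cap: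
  fixes c :: real
  assumes "CARD('n) \<ge> 2"
  shows "\<exists>N. \<forall>Y x x' h q s. finite Y \<longrightarrow> Y \<subseteq> sphere (0::real^'n) 1 \<longrightarrow>
    (\<forall>z\<in>sphere 0 1. \<exists>v\<in>Y. dist z v \<le> h) \<longrightarrow> q > 0 \<longrightarrow>
    (\<forall>v\<in>Y. \<forall>z\<in>Y. v \<noteq> z \<longrightarrow> q \<le> dist v z) \<longrightarrow> h \<le> c * q \<longrightarrow>
    x \<in> sphere 0 1 \<longrightarrow> x' \<in> sphere 0 1 \<longrightarrow>
    card (Y \<inter> cball x' s) \<le> N * card (Y \<inter> cball x (s + h))"
proof -
  obtain N where N: "\<And>p e P. e > 0 \<Longrightarrow> P \<subseteq> cball (p::real^'n) (c * e) \<Longrightarrow>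
    (\<forall>x\<in>P. \<forall>y\<in>P. x \<noteq> y \<longrightarrow> e \<le> dist x y) \<Longrightarrow> card P \<le> N"
    using separated_bounded_card[of c] by metis
  show ?thesis
  proof (intro exI[of _ N] allI impI)
    fix Y :: "(real^'n) set" and x x' :: "real^'n" and h q s
    assume Y: "finite Y" "Y \<subseteq> sphere 0 1" and dense: "\<forall>z\<in>sphere 0 1. \<exists>v\<in>Y. dist z v \<le> h"
      and q: "q > 0" and sep: "\<forall>v\<in>Y. \<forall>z\<in>Y. v \<noteq> z \<longrightarrow> q \<le> dist v z" and h: "h \<le> c * q"
      and x: "x \<in> sphere 0 1" "x' \<in> sphere 0 1"
    obtain T where T: "orthogonal_transformation T" "T x' = x"
      using orthogonal_transformation_exists[of x' x] x by auto
    have dist_T: "dist (T u) (T v) = dist u v" for u v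
      using T(1) by (metis orthogonal_transformation_isometry)
    have "\<forall>z\<in>Y. \<exists>v\<in>Y. dist (T z) v \<le> h"
      using dense Y(2) T(1) by (auto simp: subset_iff orthogonal_transformation_norm)
    then obtain f where f: "\<And>z. z \<in> Y \<Longrightarrow> f z \<in> Y \<and> dist (T z) (f z) \<le> h" by metis
    have fiber: "card {z \<in> Y. f z = v} \<le> N" for v
    proof -
      have inj: "inj_on T {z \<in> Y. f z = v}"
        using T(1) by (metis orthogonal_transformation_inj inj_on_subset subset_UNIV)
      have "card (T ` {z \<in> Y. f z = v}) \<le> N"
      proof (rule N[OF q])
        show "T ` {z \<in> Y. f z = v} \<subseteq> cball v (c * q)"
          using f h by (force simp: dist_commute)
        show "\<forall>a\<in>T ` {z \<in> Y. f z = v}. \<forall>b\<in>T ` {z \<in> Y. f z = v}. a \<noteq> b \<longrightarrow> q \<le> dist a b"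
          using sep by (auto simp: dist_T)
      qed
      then show ?thesis by (simp add: card_image[OF inj])
    qed
    have "Y \<inter> cball x' s \<subseteq> (\<Union>v\<in>Y \<inter> cball x (s + h). {z \<in> Y. f z = v})"
    proof
      fix z assume z: "z \<in> Y \<inter> cball x' s"
      have "dist x (f z) \<le> dist x (T z) + dist (T z) (f z)" by (rule dist_triangle)
      also have "dist x (T z) = dist x' z" using dist_T[of x' z] T(2) by simp
      finally show "z \<in> (\<Union>v\<in>Y \<inter> cball x (s + h). {z \<in> Y. f z = v})"
        using z f[of z] by auto
    qed
    then have "card (Y \<inter> cball x' s) \<le> card (\<Union>v\<in>Y \<inter> cball x (s + h). {z \<in> Y. f z = v})"
      using Y(1) by (intro card_mono) auto
    also have "\<dots> \<le> (\<Sum>v\<in>Y \<inter> cball x (s + h). card {z \<in> Y. f z = v})"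
      using Y(1) by (intro card_UN_le) auto
    also have "\<dots> \<le> card (Y \<inter> cball x (s + h)) * N"
      using sum_bounded_above[of "Y \<inter> cball x (s + h)" "\<lambda>v. card {z \<in> Y. f z = v}" N] fiber by simp
    finally show "card (Y \<inter> cball x' s) \<le> N * card (Y \<inter> cball x (s + h))" by (simp add: mult.commute)
  qed
qed

text \<open>The large ball is covered by boundedly many balls of radius \<open>s / 4\<close>. One
  that meets \<open>Y\<close> is recentred at a node, hence on the sphere, with radius
  \<open>s / 2\<close>; rotating it to \<open>x\<close> enlarges the radius to
  \<open>s / 2 + h\<close>, at most \<open>s\<close>.\<close>

lemma card_nodes_comparable_caps:
  fixes c l :: real
  assumes "CARD('n) \<ge> 2"
  shows "\<exists>N. \<forall>Y x y h q s. finite Y \<longrightarrow> Y \<subseteq> sphere (0::real^'n) 1 \<longrightarrow>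
    (\<forall>z\<in>sphere 0 1. \<exists>v\<in>Y. dist z v \<le> h) \<longrightarrow> q > 0 \<longrightarrow>
    (\<forall>v\<in>Y. \<forall>z\<in>Y. v \<noteq> z \<longrightarrow> q \<le> dist v z) \<longrightarrow> h \<le> c * q \<longrightarrow>
    x \<in> sphere 0 1 \<longrightarrow> s > 0 \<longrightarrow> 2 * h \<le> s \<longrightarrow>
    card (Y \<inter> cball y (l * s)) \<le> N * card (Y \<inter> cball x s)"
proof -
  obtain N1 where N1: "\<And>Y x x' h q s. finite Y \<Longrightarrow> Y \<subseteq> sphere (0::real^'n) 1 \<Longrightarrow>
    (\<forall>z\<in>sphere 0 1. \<exists>v\<in>Y. dist z v \<le> h) \<Longrightarrow> q > 0 \<Longrightarrow>
    (\<forall>v\<in>Y. \<forall>z\<in>Y. v \<noteq> z \<longrightarrow> q \<le> dist v z) \<Longrightarrow> h \<le> c * q \<Longrightarrow>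
    x \<in> sphere 0 1 \<Longrightarrow> x' \<in> sphere 0 1 \<Longrightarrow>
    card (Y \<inter> cball x' s) \<le> N1 * card (Y \<inter> cball x (s + h))"
    using card_nodes_rotated_cap[OF assms, of c] by metis
  obtain N2 where N2: "\<And>p e. e > 0 \<Longrightarrow>
      \<exists>K. finite K \<and> card K \<le> N2 \<and> cball (p::real^'n) (4 * l * e) \<subseteq> (\<Union>x\<in>K. ball x e)"
    using cball_cover_bounded_card[of "4 * l"] by blast
  show ?thesis
  proof (intro exI[of _ "N2 * N1"] allI impI)
    fix Y :: "(real^'n) set" and x y :: "real^'n" and h q s
    assume Y: "finite Y" "Y \<subseteq> sphere 0 1" and dense: "\<forall>z\<in>sphere 0 1. \<exists>v\<in>Y. dist z v \<le> h"
      and q: "q > 0" and sep: "\<forall>v\<in>Y. \<forall>z\<in>Y. v \<noteq> z \<longrightarrow> q \<le> dist v z" and h: "h \<le> c * q"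
      and x: "x \<in> sphere 0 1" and s: "s > 0" "2 * h \<le> s"
    obtain K where K: "finite K" "card K \<le> N2" "cball y (l * s) \<subseteq> (\<Union>x\<in>K. ball x (s / 4))"
      using N2[of "s / 4" y] s by auto
    let ?n = "card (Y \<inter> cball x s)"
    have small: "card (Y \<inter> ball k (s / 4)) \<le> N1 * ?n" for k
    proof (cases "Y \<inter> ball k (s / 4) = {}")
      case False
      then obtain x' where x': "x' \<in> Y" "dist k x' < s / 4" by auto
      have "Y \<inter> ball k (s / 4) \<subseteq> Y \<inter> cball x' (s / 2)"
      proof
        fix z assume z: "z \<in> Y \<inter> ball k (s / 4)"
        have "dist x' z \<le> dist k x' + dist k z" by (rule dist_triangle3)
        then show "z \<in> Y \<inter> cball x' (s / 2)" using z x' by auto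
      qed
      then have "card (Y \<inter> ball k (s / 4)) \<le> card (Y \<inter> cball x' (s / 2))"
        using Y(1) by (intro card_mono) auto
      also have "\<dots> \<le> N1 * card (Y \<inter> cball x (s / 2 + h))"
        using N1[OF Y dense q sep h x] x' Y(2) by blast
      also have "\<dots> \<le> N1 * ?n"
        by (intro mult_le_mono2 card_mono Int_mono subset_refl subset_cball) (use Y(1) s(2) in simp_all)
      finally show ?thesis .
    qed simp
    have "Y \<inter> cball y (l * s) \<subseteq> (\<Union>k\<in>K. Y \<inter> ball k (s / 4))" using K(3) by blast
    then have "card (Y \<inter> cball y (l * s)) \<le> card (\<Union>k\<in>K. Y \<inter> ball k (s / 4))"
      using Y(1) K(1) by (intro card_mono) simp_all
    also have "\<dots> \<le> (\<Sum>k\<in>K. card (Y \<inter> ball k (s / 4)))" using K(1) by (rule card_UN_le)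
    also have "\<dots> \<le> of_nat (card K) * (N1 * ?n)" using small by (rule sum_bounded_above)
    also have "\<dots> \<le> N2 * (N1 * ?n)" unfolding of_nat_id using K(2) by (rule mult_le_mono1)
    finally show "card (Y \<inter> cball y (l * s)) \<le> N2 * N1 * ?n" by (simp only: mult.assoc)
  qed
qed

section \<open>A Markov inequality in one variable\<close>

text \<open>Induction on the degree: passing from \<open>F t\<close> to \<open>F t - 2 ^ m * F (t / 2)\<close> cancels the term of
  degree \<open>m\<close> and only rescales the other coefficients by factors of modulus at least 1.\<close>
lemma coefficients_bounded_by_sup:
  "\<exists>C\<ge>0. \<forall>(c::nat \<Rightarrow> 'k::real_normed_field) M.
    (\<forall>t\<in>{0..1}. norm (\<Sum>k\<le>m. c k * of_real t ^ k) \<le> M) \<longrightarrow> (\<forall>k\<le>m. norm (c k) \<le> C * M)"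
proof (induction m)
  case 0
  show ?case by (rule exI[of _ 1]) (auto dest: bspec[of _ _ 0])
next
  case (Suc m)
  then obtain C where C: "C \<ge> 0" and bound: "\<And>(c::nat \<Rightarrow> 'k) M k.
    (\<forall>t\<in>{0..1}. norm (\<Sum>k\<le>m. c k * of_real t ^ k) \<le> M) \<Longrightarrow> k \<le> m \<Longrightarrow> norm (c k) \<le> C * M"
    by metis
  define C1 where "C1 = C * (1 + 2 ^ Suc m)"
  have C1: "C1 \<ge> 0" using C by (simp add: C1_def)
  show ?case
  proof (intro exI[of _ "1 + real (Suc m) * C1 + C1"] conjI allI impI)
    show "0 \<le> 1 + real (Suc m) * C1 + C1" using C1 by simp
    fix c :: "nat \<Rightarrow> 'k" and M k
    assume sup: "\<forall>t\<in>{0..1}. norm (\<Sum>k\<le>Suc m. c k * of_real t ^ k) \<le> M" and k: "k \<le> Suc m"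
    define F where "F t = (\<Sum>k\<le>Suc m. c k * of_real t ^ k)" for t :: real
    define d where "d k = c k * (1 - 2 ^ (Suc m - k))" for k
    have M: "M \<ge> 0" using sup by (meson atLeastAtMost_iff norm_ge_zero order_trans order_refl zero_le_one)
    have F_le: "norm (F t) \<le> M" if "t \<in> {0..1}" for t using sup that by (simp add: F_def)
    have "\<forall>t\<in>{0..1}. norm (\<Sum>k\<le>m. d k * of_real t ^ k) \<le> (1 + 2 ^ Suc m) * M"
    proof
      fix t :: real assume t: "t \<in> {0..1}"
      have "F t - 2 ^ Suc m * F (t / 2) = (\<Sum>k\<le>Suc m. d k * of_real t ^ k)"
        unfolding F_def sum_distrib_left sum_subtractf[symmetric]
      proof (intro sum.cong refl)
        fix k assume "k \<in> {..Suc m}"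
        then have "(2::'k) ^ Suc m = 2 ^ (Suc m - k) * 2 ^ k" by (simp flip: power_add)
        then have *: "2 ^ Suc m * (c k * of_real (t / 2) ^ k) = 2 ^ (Suc m - k) * (c k * of_real t ^ k)"
          by (simp add: power_divide)
        show "c k * of_real t ^ k - 2 ^ Suc m * (c k * of_real (t / 2) ^ k) = d k * of_real t ^ k"
          unfolding * by (simp add: d_def algebra_simps)
      qed
      also have "\<dots> = (\<Sum>k\<le>m. d k * of_real t ^ k)" by (simp add: d_def)
      finally have "norm (\<Sum>k\<le>m. d k * of_real t ^ k) = norm (F t - 2 ^ Suc m * F (t / 2))" by simp
      also have "\<dots> \<le> norm (F t) + norm (2 ^ Suc m * F (t / 2))" by (rule norm_triangle_ineq4)
      also have "\<dots> = norm (F t) + 2 ^ Suc m * norm (F (t / 2))" by (simp only: norm_mult norm_power norm_numeral)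
      also have "\<dots> \<le> M + 2 ^ Suc m * M"
        using t by (intro add_mono mult_left_mono F_le) auto
      finally show "norm (\<Sum>k\<le>m. d k * of_real t ^ k) \<le> (1 + 2 ^ Suc m) * M"
        by (simp add: algebra_simps)
    qed
    then have d: "norm (d k) \<le> C1 * M" if "k \<le> m" for k
      using bound[of d _ k] that by (simp add: C1_def mult.assoc)
    have low: "norm (c k) \<le> C1 * M" if "k \<le> m" for k
    proof -
      have "(2::real) \<le> 2 ^ (Suc m - k)"
        using that power_increasing[of 1 "Suc m - k" "2::real"] by simp
      moreover have "norm (1 - (2::'k) ^ (Suc m - k)) = \<bar>1 - 2 ^ (Suc m - k)\<bar>"
        by (metis norm_of_real of_real_1 of_real_diff of_real_numeral of_real_power)
      ultimately have "1 \<le> norm (1 - (2::'k) ^ (Suc m - k))" by linarith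
      then have "norm (c k) * 1 \<le> norm (d k)"
        unfolding d_def norm_mult by (intro mult_left_mono) auto
      with d[OF that] show ?thesis by simp
    qed
    show "norm (c k) \<le> (1 + real (Suc m) * C1 + C1) * M"
    proof (cases "k \<le> m")
      case True
      have "norm (c k) \<le> C1 * M" by (rule low[OF True])
      also have "\<dots> \<le> (1 + real (Suc m) * C1 + C1) * M" using C1 M by (intro mult_right_mono) auto
      finally show ?thesis .
    next
      case False
      \<comment> \<open>The cancelled top coefficient is invisible in \<open>d\<close>; it is
        recovered from the value at 1 and the lower coefficients.\<close>
      then have "c k = F 1 - (\<Sum>k\<le>m. c k)" using k by (simp add: F_def le_Suc_eq)
      then have "norm (c k) \<le> norm (F 1) + norm (\<Sum>k\<le>m. c k)" by (metis norm_triangle_ineq4)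
      also have "norm (\<Sum>k\<le>m. c k) \<le> of_nat (card {..m}) * (C1 * M)"
        by (rule sum_norm_bound) (use low in auto)
      also have "norm (F 1) \<le> M" by (rule F_le) simp
      finally have "norm (c k) \<le> M + real (Suc m) * (C1 * M)" by simp
      also have "\<dots> \<le> (1 + real (Suc m) * C1 + C1) * M"
        using mult_nonneg_nonneg[OF C1 M] by (simp add: algebra_simps)
      finally show ?thesis .
    qed
  qed
qed

section \<open>Polynomials along real curves\<close>

text \<open>A predicate with a degree bound lets sums, products and powers be handled by closure
  rules, without writing out coefficients.\<close>

definition poly_curve :: "nat \<Rightarrow> (real \<Rightarrow> 'k::real_or_complex) \<Rightarrow> bool" where
  "poly_curve m f \<longleftrightarrow> (\<exists>p. degree p \<le> m \<and> (\<forall>t. f t = poly p (of_real t)))"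

lemma poly_curve_const: "poly_curve 0 (\<lambda>_. a)"
  unfolding poly_curve_def by (rule exI[of _ "[:a:]"]) simp

lemma poly_curve_quadratic: "poly_curve 2 (\<lambda>t. of_real (a + b * t + c * t\<^sup>2))"
  unfolding poly_curve_def
  by (rule exI[of _ "[:of_real a, of_real b, of_real c:]"])
    (auto simp: algebra_simps power2_eq_square intro: order_trans[OF degree_pCons_le])

lemma poly_curve_mono: "poly_curve m f \<Longrightarrow> m \<le> n \<Longrightarrow> poly_curve n f"
  unfolding poly_curve_def by (meson order_trans)

lemma poly_curve_mult: "poly_curve m f \<Longrightarrow> poly_curve n g \<Longrightarrow> poly_curve (m + n) (\<lambda>t. f t * g t)"
  unfolding poly_curve_def by (metis add_mono degree_mult_le order_trans poly_mult)

lemma poly_curve_power: "poly_curve m f \<Longrightarrow> poly_curve (m * n) (\<lambda>t. f t ^ n)"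
  by (induction n) (use poly_curve_const[of 1] poly_curve_mult in auto)

lemma poly_curve_sum: "(\<And>i. i \<in> A \<Longrightarrow> poly_curve m (f i)) \<Longrightarrow> poly_curve m (\<lambda>t. \<Sum>i\<in>A. f i t)"
proof (induction A rule: infinite_finite_induct)
  case (insert a A)
  then obtain p q where p: "degree p \<le> m" "\<And>t. f a t = poly p (of_real t)"
    and q: "degree q \<le> m" "\<And>t. (\<Sum>i\<in>A. f i t) = poly q (of_real t)"
    unfolding poly_curve_def by (metis insertI1 insertI2)
  show ?case
    unfolding poly_curve_def using insert.hyps p q
    by (intro exI[of _ "p + q"]) (auto intro: degree_add_le)
qed (use poly_curve_mono[OF poly_curve_const[of 0]] in auto)

lemma poly_curve_prod:
  "finite A \<Longrightarrow> (\<And>i. i \<in> A \<Longrightarrow> poly_curve (m i) (f i)) \<Longrightarrow> poly_curve (sum m A) (\<lambda>t. \<Prod>i\<in>A. f i t)"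
proof (induction A rule: finite_induct)
  case (insert a A)
  then show ?case using poly_curve_mult[of "m a" "f a" "sum m A"] by simp
qed (simp add: poly_curve_const)

text \<open>Away from the constant term, \<open>t ^ k \<le> t\<close> on the unit interval, and each
  coefficient is at most a constant times \<open>M\<close>.\<close>

lemma markov_at_endpoint:
  "\<exists>C>0. \<forall>(f::real \<Rightarrow> 'k::real_or_complex) M. poly_curve m f \<longrightarrow> (\<forall>t\<in>{0..1}. norm (f t) \<le> M) \<longrightarrow>
    (\<forall>t\<in>{0..1}. norm (f t - f 0) \<le> C * M * t)"
proof -
  obtain C where C: "C \<ge> 0" and bound: "\<And>(c::nat \<Rightarrow> 'k) M k.
    (\<forall>t\<in>{0..1}. norm (\<Sum>k\<le>m. c k * of_real t ^ k) \<le> M) \<Longrightarrow> k \<le> m \<Longrightarrow> norm (c k) \<le> C * M"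
    using coefficients_bounded_by_sup[of m] by metis
  show ?thesis
  \<comment> \<open>The summand 1 keeps the constant positive even when \<open>m\<close> or
    \<open>C\<close> is 0.\<close>
  proof (intro exI[of _ "real m * C + 1"] conjI allI impI ballI)
    show "0 < real m * C + 1" using C by (simp add: add_nonneg_pos)
    fix f :: "real \<Rightarrow> 'k" and M t
    assume "poly_curve m f" and sup: "\<forall>t\<in>{0..1}. norm (f t) \<le> M" and t: "t \<in> {0..1::real}"
    then obtain p where p: "degree p \<le> m" "\<And>t. f t = poly p (of_real t)"
      unfolding poly_curve_def by auto
    have f: "f t = (\<Sum>k\<le>m. coeff p k * of_real t ^ k)" for t
      unfolding p(2) poly_altdef using p(1)
      by (intro sum.mono_neutral_left) (auto simp: coeff_eq_0)
    have M: "M \<ge> 0" using sup by (meson atLeastAtMost_iff norm_ge_zero order_trans order_refl zero_le_one)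
    have c: "norm (coeff p k) \<le> C * M" if "k \<le> m" for k
      using sup that by (intro bound[of "coeff p"]) (auto simp: f)
    have "f t - f 0 = (\<Sum>k\<in>{1..m}. coeff p k * of_real t ^ k)"
    proof -
      have "{..m} = insert 0 {1..m}" by auto
      then show ?thesis unfolding f by (simp add: power_0_left)
    qed
    also have "norm \<dots> \<le> of_nat (card {1..m}) * (C * M * t)"
    proof (rule sum_norm_bound)
      fix k assume k: "k \<in> {1..m}"
      have "t ^ k \<le> t ^ 1" using k t by (intro power_decreasing) auto
      then have "norm (coeff p k) * t ^ k \<le> C * M * t"
        using c k t M C by (intro mult_mono) auto
      then show "norm (coeff p k * of_real t ^ k) \<le> C * M * t"
        using t by (simp add: norm_mult norm_power)
    qed
    also have "\<dots> \<le> (real m * C + 1) * M * t"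
      using M t by (simp add: algebra_simps)
    finally show "norm (f t - f 0) \<le> (real m * C + 1) * M * t" .
  qed
qed

section \<open>Stereographic coordinates\<close>

lemma Hom_scale:
  assumes "p \<in> Hom l"
  shows "p (s *\<^sub>R x) = of_real (s ^ l) * p x"
proof -
  obtain c where c: "\<And>x. p x = (\<Sum>\<alpha> | sum \<alpha> UNIV = l. c \<alpha> * of_real (\<Prod>i\<in>UNIV. (x $ i) ^ \<alpha> i))"
    using assms unfolding Hom_def by auto
  have "(\<Prod>i\<in>UNIV. ((s *\<^sub>R x) $ i) ^ \<alpha> i) = s ^ l * (\<Prod>i\<in>UNIV. (x $ i) ^ \<alpha> i)"
    if "sum \<alpha> UNIV = l" for \<alpha>
    using that by (simp add: power_mult_distrib prod.distrib flip: power_sum)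
  then show ?thesis unfolding c sum_distrib_left
    by (intro sum.cong refl) (simp add: mult_ac)
qed

lemma continuous_on_Hom:
  assumes "p \<in> Hom l"
  shows "continuous_on S p"
proof -
  obtain c where "p = (\<lambda>x. \<Sum>\<alpha> | sum \<alpha> UNIV = l. c \<alpha> * of_real (\<Prod>i\<in>UNIV. (x $ i) ^ \<alpha> i))"
    using assms unfolding Hom_def by auto
  then show ?thesis by (simp only:) (intro continuous_intros)
qed

text \<open>Quadratic curves are the relevant case: along a line in stereographic coordinates the
  numerator of the projection is quadratic in the parameter.\<close>

lemma poly_curve_Hom:
  fixes p :: "real^'n \<Rightarrow> 'k::real_or_complex" and u :: "real \<Rightarrow> real^'n"
  assumes "p \<in> Hom l" and u: "\<And>i. \<exists>a b c. \<forall>t. u t $ i = a + b * t + c * t\<^sup>2"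
  shows "poly_curve (2 * l) (\<lambda>t. p (u t))"
proof -
  obtain c where c: "\<And>x. p x = (\<Sum>\<alpha> | sum \<alpha> UNIV = l. c \<alpha> * of_real (\<Prod>i\<in>UNIV. (x $ i) ^ \<alpha> i))"
    using assms unfolding Hom_def by auto
  have coord: "poly_curve 2 (\<lambda>t. of_real (u t $ i) :: 'k)" for i
    using u[of i] poly_curve_quadratic by (metis (no_types, lifting) ext)
  have "poly_curve (2 * l) (\<lambda>t. c \<alpha> * (\<Prod>i\<in>UNIV. of_real (u t $ i) ^ \<alpha> i))" if "sum \<alpha> UNIV = l" for \<alpha>
  proof -
    have "poly_curve (\<Sum>i\<in>UNIV. 2 * \<alpha> i) (\<lambda>t. \<Prod>i\<in>UNIV. (of_real (u t $ i) :: 'k) ^ \<alpha> i)"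
      by (intro poly_curve_prod poly_curve_power coord) simp
    from poly_curve_mult[OF poly_curve_const this, of "c \<alpha>"] show ?thesis
      using that by (simp flip: sum_distrib_left)
  qed
  then show ?thesis unfolding c by (intro poly_curve_sum) simp
qed

text \<open>Keeps the homogeneity of the summands, which is what later allows the denominators of
  the stereographic projection to be cleared.\<close>

lemma sph_harmonics_eq_sum_Hom:
  assumes "g \<in> sph_harmonics L"
  obtains p where "\<And>l. l \<le> L \<Longrightarrow> p l \<in> Hom l" "\<And>z. z \<in> sphere 0 1 \<Longrightarrow> g z = (\<Sum>l\<le>L. p l z)"
proof -
  obtain f where f: "\<And>l. l \<le> L \<Longrightarrow> f l \<in> Harm l" "g = (\<lambda>x. \<Sum>l\<le>L. f l x)"
    using assms unfolding sph_harmonics_def by auto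
  have "\<exists>p. l \<le> L \<longrightarrow> p \<in> Hom l \<and> f l = on_sphere p" for l
    using f(1)[of l] unfolding Harm_def by blast
  then obtain p where "\<And>l. l \<le> L \<Longrightarrow> p l \<in> Hom l \<and> f l = on_sphere (p l)" by metis
  then show thesis using f(2) by (intro that[of p]) (auto simp: on_sphere_def)
qed

section \<open>Geometry of the stereographic projection\<close>

text \<open>For unit \<open>y\<close> and \<open>u\<close> orthogonal to \<open>y\<close>, the
  inverse stereographic projection with pole \<open>- y\<close>: the origin goes to \<open>y\<close>
  and the unit sphere of the hyperplane is fixed.\<close>

definition stereo :: "real^'n \<Rightarrow> real^'n \<Rightarrow> real^'n" where
  "stereo y u = (1 / (1 + u \<bullet> u)) *\<^sub>R ((1 - u \<bullet> u) *\<^sub>R y + 2 *\<^sub>R u)"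

lemma inner_stereo:
  assumes "norm y = 1" "y \<bullet> u = 0" "y \<bullet> v = 0"
  shows "stereo y u \<bullet> stereo y v =
    ((1 - u \<bullet> u) * (1 - v \<bullet> v) + 4 * (u \<bullet> v)) / ((1 + u \<bullet> u) * (1 + v \<bullet> v))"
proof -
  have "y \<bullet> y = 1" using assms(1) by (simp add: norm_eq_1)
  then show ?thesis
    using assms by (simp add: stereo_def inner_add_left inner_add_right inner_commute mult.commute)
qed

lemma norm_stereo:
  assumes "norm y = 1" "y \<bullet> u = 0"
  shows "norm (stereo y u) = 1"
proof -
  have "1 + u \<bullet> u \<noteq> 0" using inner_ge_zero[of u] by linarith
  moreover have "(1 - u \<bullet> u) * (1 - u \<bullet> u) + 4 * (u \<bullet> u) = (1 + u \<bullet> u) * (1 + u \<bullet> u)"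
    by (simp add: algebra_simps)
  ultimately show ?thesis unfolding norm_eq_1 inner_stereo[OF assms assms(2)] by simp
qed

text \<open>The chordal distance formula, multiplied out to avoid roots. The factor on the left is
  at least 1, and at most 4 on the unit ball, which gives the two Lipschitz bounds below.\<close>

lemma dist_stereo:
  assumes "norm y = 1" "y \<bullet> u = 0" "y \<bullet> v = 0"
  shows "(dist (stereo y u) (stereo y v))\<^sup>2 * ((1 + u \<bullet> u) * (1 + v \<bullet> v)) = 4 * (dist u v)\<^sup>2"
proof -
  let ?d = "(1 + u \<bullet> u) * (1 + v \<bullet> v)"
  have d: "?d > 0" by (intro mult_pos_pos add_pos_nonneg) auto
  have "(dist (stereo y u) (stereo y v))\<^sup>2 = 2 - 2 * (stereo y u \<bullet> stereo y v)"
    using norm_stereo[OF assms(1,2)] norm_stereo[OF assms(1,3)]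
    by (simp add: dist_norm power2_norm_eq_inner inner_diff inner_commute norm_eq_1)
  also have "\<dots> * ?d = 2 * ?d - 2 * ((1 - u \<bullet> u) * (1 - v \<bullet> v) + 4 * (u \<bullet> v))"
  proof -
    have "(2 - 2 * (a / b)) * b = 2 * b - 2 * a" if "b > 0" for a b :: real
      using that by (simp add: field_simps)
    from this[OF d] show ?thesis unfolding inner_stereo[OF assms] .
  qed
  also have "\<dots> = 4 * (dist u v)\<^sup>2"
    by (simp add: dist_norm power2_norm_eq_inner inner_diff inner_commute algebra_simps)
  finally show ?thesis .
qed

lemma dist_stereo_le:
  assumes "norm y = 1" "y \<bullet> u = 0" "y \<bullet> v = 0"
  shows "dist (stereo y u) (stereo y v) \<le> 2 * dist u v"
proof (rule power2_le_imp_le)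
  have "1 * 1 \<le> (1 + u \<bullet> u) * (1 + v \<bullet> v)" by (intro mult_mono) auto
  then have "(dist (stereo y u) (stereo y v))\<^sup>2 * 1
      \<le> (dist (stereo y u) (stereo y v))\<^sup>2 * ((1 + u \<bullet> u) * (1 + v \<bullet> v))"
    by (intro mult_left_mono) auto
  then show "(dist (stereo y u) (stereo y v))\<^sup>2 \<le> (2 * dist u v)\<^sup>2"
    unfolding dist_stereo[OF assms] by (simp add: power_mult_distrib)
qed simp

lemma dist_le_dist_stereo:
  assumes "norm y = 1" "y \<bullet> u = 0" "y \<bullet> v = 0" and "norm u \<le> 1" "norm v \<le> 1"
  shows "dist u v \<le> dist (stereo y u) (stereo y v)"
proof (rule power2_le_imp_le)
  have "u \<bullet> u \<le> 1" "v \<bullet> v \<le> 1"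
    using assms(4,5) by (auto simp: norm_eq_sqrt_inner)
  then have "(1 + u \<bullet> u) * (1 + v \<bullet> v) \<le> 2 * 2" by (intro mult_mono) auto
  then have "(dist (stereo y u) (stereo y v))\<^sup>2 * ((1 + u \<bullet> u) * (1 + v \<bullet> v))
      \<le> (dist (stereo y u) (stereo y v))\<^sup>2 * (2 * 2)"
    by (intro mult_left_mono) auto
  then show "(dist u v)\<^sup>2 \<le> (dist (stereo y u) (stereo y v))\<^sup>2"
    unfolding dist_stereo[OF assms(1-3)] by simp
qed simp

lemma stereo_surj:
  assumes "norm y = 1" "norm z = 1" and k: "0 \<le> y \<bullet> z"
  obtains u where "y \<bullet> u = 0" "norm u \<le> 1" "stereo y u = z"
proof
  define k where "k = y \<bullet> z"
  have k0: "0 \<le> k" using k by (simp add: k_def)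
  have inner: "y \<bullet> y = 1" "z \<bullet> z = 1" using assms by (simp_all add: norm_eq_1)
  \<comment> \<open>The point where the line from \<open>- y\<close> through \<open>z\<close> meets
    the hyperplane orthogonal to \<open>y\<close>.\<close>
  define u where "u = (1 / (1 + k)) *\<^sub>R (z - k *\<^sub>R y)"
  show "y \<bullet> u = 0" by (simp add: u_def inner_diff_right inner k_def)
  have "u \<bullet> u = (1 / (1 + k))\<^sup>2 * ((z - k *\<^sub>R y) \<bullet> (z - k *\<^sub>R y))"
    by (simp add: u_def power2_eq_square)
  also have "(z - k *\<^sub>R y) \<bullet> (z - k *\<^sub>R y) = (1 - k) * (1 + k)"
    by (simp add: inner_diff inner k_def[symmetric] inner_commute[of z y] algebra_simps)
  finally have uu: "u \<bullet> u = (1 - k) / (1 + k)" using k0 by (simp add: power2_eq_square)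
  have "u \<bullet> u \<le> 1" unfolding uu using k0 by simp
  then show "norm u \<le> 1" by (simp add: norm_eq_sqrt_inner)
  have 1: "1 + u \<bullet> u = 2 / (1 + k)" "1 - u \<bullet> u = 2 * k / (1 + k)"
    unfolding uu using k0 by (simp_all add: field_simps)
  have "stereo y u = ((1 + k) / 2) *\<^sub>R ((2 * k / (1 + k)) *\<^sub>R y + (2 / (1 + k)) *\<^sub>R (z - k *\<^sub>R y))"
    unfolding stereo_def 1 by (simp add: u_def)
  also have "\<dots> = k *\<^sub>R y + (z - k *\<^sub>R y)"
  proof -
    have "(1 + k) / 2 * (2 * k / (1 + k)) = k" "(1 + k) / 2 * (2 / (1 + k)) = 1"
      using k0 by (simp_all add: field_simps)
    then show ?thesis by (simp only: scaleR_add_right scaleR_scaleR scaleR_one)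
  qed
  finally show "stereo y u = z" by simp
qed

text \<open>The centre \<open>x\<close> depends on \<open>g\<close>, but the constants depend only
  on the degree: the Markov constant is for degree \<open>2 * L\<close> in one variable and is
  unaffected by rescaling the segments.\<close>

lemma sph_harmonics_cap_lower_bound:
  "\<exists>\<kappa>>0. \<exists>C>0. \<forall>g\<in>(sph_harmonics L :: (real^'n \<Rightarrow> 'k::real_or_complex) set).
    \<forall>y\<in>sphere 0 1. \<forall>\<rho>. 0 < \<rho> \<longrightarrow> \<rho> \<le> 1 \<longrightarrow>
      (\<exists>x\<in>sphere 0 1. sphere 0 1 \<inter> cball x (\<kappa> * \<rho>) \<subseteq> cball y \<rho> \<and>
        (\<forall>z\<in>sphere 0 1 \<inter> cball x (\<kappa> * \<rho>). norm (g y) \<le> C * norm (g z)))"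
proof -
  obtain C where C: "C > 0" and markov: "\<And>(f::real \<Rightarrow> 'k) M t. poly_curve (2 * L) f \<Longrightarrow>
      (\<forall>t\<in>{0..1}. norm (f t) \<le> M) \<Longrightarrow> t \<in> {0..1} \<Longrightarrow> norm (f t - f 0) \<le> C * M * t"
    using markov_at_endpoint[of "2 * L"] by blast
  \<comment> \<open>Markov will be evaluated at the parameter \<open>2 * \<eta>\<close>: the first
    bound keeps this in the unit interval, the second limits the loss
    \<open>C * M * (2 * \<eta>)\<close> to \<open>M / 2\<close>.\<close>
  define \<eta> where "\<eta> = min (1 / 4) (1 / (4 * C))"
  have \<eta>: "0 < \<eta>" "\<eta> \<le> 1 / 4" and C\<eta>: "C * \<eta> \<le> 1 / 4"
  proof -
    show "0 < \<eta>" "\<eta> \<le> 1 / 4" using C by (auto simp: \<eta>_def)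
    have "C * \<eta> \<le> C * (1 / (4 * C))" using C by (intro mult_left_mono) (auto simp: \<eta>_def)
    then show "C * \<eta> \<le> 1 / 4" using C by simp
  qed
  have main: "\<exists>x\<in>sphere 0 1. sphere 0 1 \<inter> cball x (\<eta> / 8 * \<rho>) \<subseteq> cball y \<rho> \<and>
      (\<forall>z\<in>sphere 0 1 \<inter> cball x (\<eta> / 8 * \<rho>). norm (g y) \<le> 2 * 2 ^ L * norm (g z))"
    if g: "g \<in> sph_harmonics L" and y: "y \<in> sphere 0 1" and \<rho>: "0 < \<rho>" "\<rho> \<le> 1"
    for g :: "real^'n \<Rightarrow> 'k" and y :: "real^'n" and \<rho> :: real
  proof -
    from y have norm_y: "norm y = 1" by simp
    obtain p where p: "\<And>l. l \<le> L \<Longrightarrow> p l \<in> Hom l"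
      and gp: "\<And>z. z \<in> sphere 0 1 \<Longrightarrow> g z = (\<Sum>l\<le>L. p l z)"
      using sph_harmonics_eq_sum_Hom[OF g] by metis
    \<comment> \<open>As \<open>stereo\<close> at most doubles distances, the disc of radius
      \<open>\<tau>\<close> lands within \<open>\<rho> / 2\<close> of \<open>y\<close>, leaving room
      for a cap around its points.\<close>
    define \<tau> where "\<tau> = \<rho> / 4"
    have \<tau>: "0 < \<tau>" "\<tau> \<le> 1 / 4" using \<rho> by (auto simp: \<tau>_def)
    define num where "num u = (1 - u \<bullet> u) *\<^sub>R y + 2 *\<^sub>R u" for u
    text \<open>Multiplying by \<open>(1 + u \<bullet> u) ^ L\<close> clears the denominators of the coordinates.\<close>
    define Q where "Q u = (\<Sum>l\<le>L. of_real ((1 + u \<bullet> u) ^ (L - l)) * p l (num u))" for u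
    have Q_stereo: "Q u = of_real ((1 + u \<bullet> u) ^ L) * g (stereo y u)" if u: "y \<bullet> u = 0" for u
    proof -
      have nz: "1 + u \<bullet> u \<noteq> 0" using inner_ge_zero[of u] by linarith
      have "of_real ((1 + u \<bullet> u) ^ L) * p l (stereo y u)
          = of_real ((1 + u \<bullet> u) ^ (L - l)) * p l (num u)" if "l \<le> L" for l
      proof -
        have "(1 + u \<bullet> u) ^ L * (1 / (1 + u \<bullet> u)) ^ l = (1 + u \<bullet> u) ^ (L - l)"
          using that nz by (simp add: power_diff power_one_over)
        then show ?thesis
          unfolding stereo_def num_def[symmetric] Hom_scale[OF p[OF that]]
          by (metis mult.assoc of_real_mult)
      qed
      then show ?thesis
        unfolding Q_def by (simp add: gp norm_stereo[OF norm_y u] sum_distrib_left)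
    qed
    have cont: "continuous_on UNIV Q"
    proof -
      have "continuous_on UNIV (\<lambda>u. p l (num u))" if "l \<le> L" for l
        unfolding num_def
        by (rule continuous_on_compose2[OF continuous_on_Hom[OF p[OF that], of UNIV]])
          (auto intro!: continuous_intros)
      then show ?thesis unfolding Q_def by (auto intro!: continuous_intros)
    qed
    \<comment> \<open>Each summand has degree at most \<open>2 * (L - l) + 2 * l\<close>, so all
      share the bound \<open>2 * L\<close>.\<close>
    have curve: "poly_curve (2 * L) (\<lambda>t. Q (a + t *\<^sub>R b))" for a b
    proof -
      have uu: "(a + t *\<^sub>R b) \<bullet> (a + t *\<^sub>R b) = a \<bullet> a + (2 * (a \<bullet> b)) * t + (b \<bullet> b) * t\<^sup>2" for t
        by (simp add: inner_add_left inner_add_right inner_commute power2_eq_square algebra_simps)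
      have summand: "poly_curve (2 * (L - l) + 2 * l)
          (\<lambda>t. of_real ((1 + (a + t *\<^sub>R b) \<bullet> (a + t *\<^sub>R b)) ^ (L - l)) * p l (num (a + t *\<^sub>R b)))"
        if "l \<le> L" for l
      proof (rule poly_curve_mult)
        have "poly_curve 2 (\<lambda>t. of_real (1 + (a + t *\<^sub>R b) \<bullet> (a + t *\<^sub>R b)) :: 'k)"
          using poly_curve_quadratic[of "1 + a \<bullet> a" "2 * (a \<bullet> b)" "b \<bullet> b"]
          unfolding uu by (simp only: add.assoc)
        from poly_curve_power[OF this, of "L - l"] show "poly_curve (2 * (L - l))
            (\<lambda>t. of_real ((1 + (a + t *\<^sub>R b) \<bullet> (a + t *\<^sub>R b)) ^ (L - l)) :: 'k)"
          by (simp only: of_real_power)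
        show "poly_curve (2 * l) (\<lambda>t. p l (num (a + t *\<^sub>R b)))"
        proof (rule poly_curve_Hom[OF p[OF that]], intro exI allI)
          fix i t
          show "num (a + t *\<^sub>R b) $ i = ((1 - a \<bullet> a) * y $ i + 2 * a $ i)
              + (2 * b $ i - 2 * (a \<bullet> b) * y $ i) * t + (- (b \<bullet> b) * y $ i) * t\<^sup>2"
            unfolding num_def uu by (simp add: algebra_simps)
        qed
      qed
      show ?thesis unfolding Q_def by (rule poly_curve_sum, rule poly_curve_mono[OF summand]) auto
    qed
    define D where "D = {u. y \<bullet> u = 0} \<inter> cball 0 \<tau>"
    have "compact D" unfolding D_def by (intro closed_Int_compact closed_hyperplane compact_cball)
    moreover have "0 \<in> D" using \<tau> by (simp add: D_def)
    ultimately obtain x0 where x0: "x0 \<in> D" and max: "\<And>u. u \<in> D \<Longrightarrow> norm (Q u) \<le> norm (Q x0)"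
      using continuous_attains_sup[of D "\<lambda>u. norm (Q u)"] continuous_on_subset[OF cont]
      by (metis continuous_on_norm empty_iff subset_UNIV)
    define M where "M = norm (Q x0)"
    have "stereo y 0 = y" by (simp add: stereo_def)
    then have gy: "norm (g y) \<le> M"
      using max[OF \<open>0 \<in> D\<close>] Q_stereo[of 0] by (simp add: M_def)
    have x0': "y \<bullet> x0 = 0" "norm x0 \<le> \<tau>" using x0 by (auto simp: D_def)
    \<comment> \<open>The maximum point may lie on the boundary of \<open>D\<close>; pulling it
      inwards gives a centre whose neighbours all lie in directions from \<open>x0\<close> that stay
      in \<open>D\<close>.\<close>
    define x1 where "x1 = (1 - \<eta>) *\<^sub>R x0"
    have x1: "y \<bullet> x1 = 0" "norm x1 \<le> \<tau>"
    proof -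
      show "y \<bullet> x1 = 0" using x0' by (simp add: x1_def)
      have "norm x1 = (1 - \<eta>) * norm x0" using \<eta> by (simp add: x1_def)
      also have "\<dots> \<le> 1 * \<tau>" using \<eta> x0' by (intro mult_mono) auto
      finally show "norm x1 \<le> \<tau>" by simp
    qed
    text \<open>The segment from \<open>x0\<close> towards \<open>v\<close> can be prolonged inside \<open>D\<close> by the factor
      \<open>1 / (2 * \<eta>)\<close>, so \<open>Q\<close> varies little between \<open>x0\<close> and \<open>v\<close>.\<close>
    have near: "M / 2 \<le> norm (Q v)" if v: "y \<bullet> v = 0" "dist x1 v \<le> \<eta> * \<tau> / 2" for v
    proof -
      define b where "b = (1 / (2 * \<eta>)) *\<^sub>R (v - x0)"
      have inD: "x0 + t *\<^sub>R b \<in> D" if t: "t \<in> {0..1}" for t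
      proof -
        define r where "r = t / (2 * \<eta>)"
        have r: "0 \<le> r" using t \<eta> by (simp add: r_def)
        have r\<eta>: "r * \<eta> \<le> 1 / 2" using t \<eta> by (simp add: r_def)
        have "x0 + t *\<^sub>R b = (1 - r * \<eta>) *\<^sub>R x0 + r *\<^sub>R (v - x1)"
          unfolding b_def x1_def r_def using \<eta> by (simp add: algebra_simps)
        also have "norm \<dots> \<le> (1 - r * \<eta>) * norm x0 + r * dist x1 v"
          using r r\<eta> by (intro order_trans[OF norm_triangle_ineq])
            (simp add: dist_norm norm_minus_commute)
        also have "\<dots> \<le> (1 - r * \<eta>) * \<tau> + r * (\<eta> * \<tau> / 2)"
          using r r\<eta> x0' v by (intro add_mono mult_left_mono) auto
        also have "\<dots> = \<tau> - (r * \<eta>) * \<tau> / 2" by (simp add: algebra_simps)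
        also have "\<dots> \<le> \<tau>" using r \<eta> \<tau> by simp
        finally have "norm (x0 + t *\<^sub>R b) \<le> \<tau>" .
        moreover have "y \<bullet> (x0 + t *\<^sub>R b) = 0"
          using x0' v by (simp add: b_def inner_add_right inner_diff_right)
        ultimately show ?thesis by (simp add: D_def)
      qed
      have "norm (Q (x0 + (2 * \<eta>) *\<^sub>R b) - Q (x0 + 0 *\<^sub>R b)) \<le> C * M * (2 * \<eta>)"
        using \<eta> inD max by (intro markov[OF curve]) (auto simp: M_def)
      also have "x0 + (2 * \<eta>) *\<^sub>R b = v" using \<eta> by (simp add: b_def)
      also have "C * M * (2 * \<eta>) = (C * \<eta>) * (2 * M)" by simp
      also have "\<dots> \<le> 1 / 4 * (2 * M)" using C\<eta> by (intro mult_right_mono) (auto simp: M_def)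
      finally have "norm (Q v - Q x0) \<le> M / 2" by simp
      moreover have "norm (Q x0) - norm (Q v) \<le> norm (Q v - Q x0)"
        by (metis norm_minus_commute norm_triangle_ineq2)
      ultimately show ?thesis by (simp add: M_def)
    qed
    define x where "x = stereo y x1"
    have x: "x \<in> sphere 0 1" using norm_stereo[OF norm_y x1(1)] by (simp add: x_def)
    have "dist x y \<le> 2 * dist x1 0"
      using dist_stereo_le[OF norm_y x1(1), of 0] \<open>stereo y 0 = y\<close> by (simp add: x_def)
    then have xy: "dist x y \<le> \<rho> / 2" using x1(2) by (simp add: \<tau>_def)
    have radius: "\<eta> / 8 * \<rho> = \<eta> * \<tau> / 2" by (simp add: \<tau>_def)
    have in_cap: "dist y z \<le> \<rho>" if "dist x z \<le> \<eta> * \<tau> / 2" for z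
    proof -
      have "\<eta> * \<tau> \<le> 1 / 4 * \<tau>" using \<eta> \<tau> by (intro mult_right_mono) auto
      then have "dist x z \<le> \<tau>" using that \<tau>(1) by linarith
      then have "dist x z \<le> \<rho> / 2" using \<rho>(1) by (simp add: \<tau>_def)
      then show ?thesis using xy dist_triangle3[of y z x] by linarith
    qed
    \<comment> \<open>Since \<open>\<rho> \<le> 1\<close>, the point \<open>z\<close> lies in the
      hemisphere around \<open>y\<close> and has a coordinate \<open>v\<close> in the unit ball. The
      factor 2 comes from \<open>M / 2\<close>, and \<open>2 ^ L\<close> bounds the cleared
      denominator.\<close>
    have "norm (g y) \<le> 2 * 2 ^ L * norm (g z)"
      if z: "z \<in> sphere 0 1" "dist x z \<le> \<eta> * \<tau> / 2" for z
    proof -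
      have norm_z: "norm z = 1" using z by simp
      have "(dist y z)\<^sup>2 \<le> 1\<^sup>2" using in_cap[OF z(2)] \<rho> by (intro power_mono) auto
      moreover have "(dist y z)\<^sup>2 = 2 - 2 * (y \<bullet> z)"
        using norm_y norm_z
        by (simp add: dist_norm power2_norm_eq_inner inner_diff inner_commute norm_eq_1)
      ultimately have "0 \<le> y \<bullet> z" by simp
      then obtain v where v: "y \<bullet> v = 0" "norm v \<le> 1" "stereo y v = z"
        using stereo_surj[OF norm_y norm_z] by metis
      have "dist x1 v \<le> dist x z"
        using dist_le_dist_stereo[OF norm_y x1(1) v(1) _ v(2)] x1(2) \<tau> v(3) by (simp add: x_def)
      then have "M / 2 \<le> norm (Q v)" using near[OF v(1)] z(2) by simp
      also have "\<dots> = (1 + v \<bullet> v) ^ L * norm (g z)"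
        by (simp add: Q_stereo[OF v(1)] v(3) norm_mult norm_power add_nonneg_nonneg del: of_real_power of_real_add)
      also have "\<dots> \<le> 2 ^ L * norm (g z)"
        using v(2) by (intro mult_right_mono power_mono) (auto simp: norm_eq_sqrt_inner)
      finally show ?thesis using gy by simp
    qed
    then show ?thesis
      using x in_cap unfolding radius by (intro bexI[of _ x]) auto
  qed
  show ?thesis
  proof (rule exI[of _ "\<eta> / 8"], rule conjI)
    show "\<exists>C>0. \<forall>g\<in>(sph_harmonics L :: (real^'n \<Rightarrow> 'k) set). \<forall>y\<in>sphere 0 1. \<forall>\<rho>. 0 < \<rho> \<longrightarrow> \<rho> \<le> 1 \<longrightarrow>
      (\<exists>x\<in>sphere 0 1. sphere 0 1 \<inter> cball x (\<eta> / 8 * \<rho>) \<subseteq> cball y \<rho> \<and>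
        (\<forall>z\<in>sphere 0 1 \<inter> cball x (\<eta> / 8 * \<rho>). norm (g y) \<le> C * norm (g z)))"
      by (rule exI[of _ "2 * 2 ^ L"]) (use main in simp)
  qed (use \<eta> in simp)
qed

section \<open>Boundedness of the Lebesgue constant\<close>

text \<open>Passes from great circle to Euclidean distances. The factor \<open>1/2\<close> in the
  separation distance absorbs the loss between arc and chord.\<close>

lemma node_set_bounds:
  fixes Y :: "(real^'n) set"
  assumes "CARD('n) \<ge> 2" "node_set Y"
  shows "fill_distance Y > 0" "separation_distance Y > 0"
    and "\<And>y. y \<in> sphere 0 1 \<Longrightarrow> \<exists>z\<in>Y. dist y z \<le> fill_distance Y"
    and "\<And>y z. y \<in> Y \<Longrightarrow> z \<in> Y \<Longrightarrow> y \<noteq> z \<Longrightarrow> separation_distance Y \<le> dist y z"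
proof -
  have Y: "finite Y" "card Y \<ge> 2" "Y \<subseteq> sphere 0 1" using assms by (auto simp: node_set_def)
  have "Y \<noteq> {}" using Y(2) by auto
  have bdd: "bdd_above ((\<lambda>y. Min ((\<lambda>z. gc_dist z y) ` Y)) ` sphere 0 1)"
  proof (rule bdd_aboveI2)
    fix y :: "real^'n" assume y: "y \<in> sphere 0 1"
    obtain z where z: "z \<in> Y" using \<open>Y \<noteq> {}\<close> by auto
    have "Min ((\<lambda>z. gc_dist z y) ` Y) \<le> gc_dist z y" using Y(1) z by (intro Min_le) auto
    also have "\<dots> \<le> pi" using gc_dist_bounds(2) y z Y(3) by blast
    finally show "Min ((\<lambda>z. gc_dist z y) ` Y) \<le> pi" .
  qed
  show dense: "\<exists>z\<in>Y. dist y z \<le> fill_distance Y" if y: "y \<in> sphere 0 1" for y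
  proof -
    have "Min ((\<lambda>z. gc_dist z y) ` Y) \<in> (\<lambda>z. gc_dist z y) ` Y"
      using Y(1) \<open>Y \<noteq> {}\<close> by (intro Min_in) auto
    then obtain z where z: "z \<in> Y" "Min ((\<lambda>z. gc_dist z y) ` Y) = gc_dist z y" by auto
    have "dist y z \<le> gc_dist z y"
      using gc_dist_bounds(3)[of z y] z(1) Y(3) y by (auto simp: dist_commute)
    also have "\<dots> \<le> fill_distance Y"
      unfolding fill_distance_def z(2)[symmetric] by (rule cSUP_upper[OF y bdd])
    finally show ?thesis using z(1) by blast
  qed
  \<comment> \<open>Otherwise every point of the sphere is a node; in dimension at least 2 the
    sphere is connected, so being finite it would be a single point.\<close>
  show "fill_distance Y > 0"
  proof (rule ccontr)
    assume "\<not> fill_distance Y > 0"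
    have "sphere 0 1 \<subseteq> Y"
    proof
      fix y :: "real^'n" assume "y \<in> sphere 0 1"
      with dense obtain z where "z \<in> Y" "dist y z \<le> fill_distance Y" by blast
      with \<open>\<not> fill_distance Y > 0\<close> show "y \<in> Y"
        by (metis dist_le_zero_iff linorder_not_less order_trans)
    qed
    with Y(3) have "Y = sphere 0 1" by simp
    moreover have "connected (sphere (0::real^'n) 1)"
      using assms(1) by (intro connected_sphere) simp
    ultimately obtain a where "Y = {a}"
      using Y(1) \<open>Y \<noteq> {}\<close> connected_finite_iff_sing by blast
    then show False using Y(2) by simp
  qed
  let ?D = "{gc_dist y z | y z. y \<in> Y \<and> z \<in> Y \<and> y \<noteq> z}"
  have "?D \<subseteq> (\<lambda>(y, z). gc_dist y z) ` (Y \<times> Y)" by auto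
  then have finD: "finite ?D" using Y(1) by (meson finite_SigmaI finite_imageI finite_subset)
  have sep_le: "2 * separation_distance Y \<le> gc_dist y z" if "y \<in> Y" "z \<in> Y" "y \<noteq> z" for y z
    using that finD by (auto simp: separation_distance_def intro!: Min_le)
  show "separation_distance Y \<le> dist y z" if "y \<in> Y" "z \<in> Y" "y \<noteq> z" for y z
  proof -
    have "gc_dist y z \<le> 2 * dist y z" using gc_dist_bounds(4) that(1,2) Y(3) by blast
    then show ?thesis using sep_le[OF that] by linarith
  qed
  have "?D \<noteq> {}"
  proof -
    obtain y where y: "y \<in> Y" using \<open>Y \<noteq> {}\<close> by auto
    have "Y \<noteq> {y}" using Y(2) by auto
    then obtain z where "z \<in> Y" "z \<noteq> y" using y by blast
    then show ?thesis using y by blast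
  qed
  then have "Min ?D \<in> ?D" by (rule Min_in[OF finD])
  then obtain y z where yz: "y \<in> Y" "z \<in> Y" "y \<noteq> z" "Min ?D = gc_dist y z" by auto
  have "0 < dist y z" using yz(3) by simp
  also have "\<dots> \<le> gc_dist y z" using gc_dist_bounds(3) yz Y(3) by blast
  finally show "separation_distance Y > 0" unfolding separation_distance_def yz(4) by simp
qed

text \<open>Cauchy-Schwarz after inserting \<open>sqrt (w z y)\<close> and its inverse. Uniqueness
  is what makes the description in the Lebesgue constant denote the minimizer.\<close>

lemma lebesgue_constant_le_sqrt:
  fixes G :: "(real^'n \<Rightarrow> 'k::real_or_complex) set"
  assumes G: "module.subspace fun_scale G" and Y: "finite Y" and "B \<ge> 0"
    and B: "\<And>g. g \<in> G \<Longrightarrow> (norm (g y))\<^sup>2 \<le> B * (\<Sum>z\<in>active w Y y. w z y * (norm (g z))\<^sup>2)"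
  shows "\<exists>!a. is_minimizer G w Y y a"
    and "lebesgue_constant G w Y y \<le> sqrt ((\<Sum>z\<in>active w Y y. w z y) * B)"
proof -
  obtain a where a: "is_minimizer G w Y y a" "\<And>b. is_minimizer G w Y y b \<Longrightarrow> b = a"
    and obj: "objective w Y y a \<le> B"
    using least_squares_minimizer[OF G Y \<open>B \<ge> 0\<close> B] by blast
  then show "\<exists>!a. is_minimizer G w Y y a" by blast
  have THE_a: "(THE a. is_minimizer G w Y y a) = a" using a by (rule the_equality)
  let ?A = "active w Y y"
  have w: "w z y > 0" if "z \<in> ?A" for z using that by (simp add: active_def)
  have "(\<Sum>z\<in>?A. norm (a z)) = (\<Sum>z\<in>?A. sqrt (w z y) * (norm (a z) / sqrt (w z y)))"
    using w by (intro sum.cong refl) force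
  then have "(\<Sum>z\<in>?A. norm (a z))\<^sup>2
      \<le> (\<Sum>z\<in>?A. (sqrt (w z y))\<^sup>2) * (\<Sum>z\<in>?A. (norm (a z) / sqrt (w z y))\<^sup>2)"
    by (simp only: Cauchy_Schwarz_ineq_sum)
  also have "(\<Sum>z\<in>?A. (sqrt (w z y))\<^sup>2) = (\<Sum>z\<in>?A. w z y)"
    using w by (intro sum.cong refl) (simp add: less_imp_le)
  also have "(\<Sum>z\<in>?A. (norm (a z) / sqrt (w z y))\<^sup>2) = objective w Y y a"
    unfolding objective_def using w
    by (intro sum.cong refl) (simp add: power_divide less_imp_le)
  also have "(\<Sum>z\<in>?A. w z y) * objective w Y y a \<le> (\<Sum>z\<in>?A. w z y) * B"
    using w obj by (intro mult_left_mono sum_nonneg) (simp_all add: less_imp_le)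
  finally show "lebesgue_constant G w Y y \<le> sqrt ((\<Sum>z\<in>?A. w z y) * B)"
    unfolding lebesgue_constant_def THE_a by (rule real_le_rsqrt)
qed

theorem theorem4p5:
  fixes \<phi> :: "real \<Rightarrow> real" and L :: nat and c :: real
    and G :: "(real^'n \<Rightarrow> 'k::real_or_complex) set"
  assumes "CARD('n) \<ge> 2"
    and "continuous_on {0..} \<phi>"
    and "\<forall>t\<ge>0. \<phi> t \<ge> 0"
    and "\<forall>t. 0 \<le> t \<and> t \<le> 1/2 \<longrightarrow> \<phi> t > 0"
    and "\<forall>t\<ge>1. \<phi> t = 0"
    and "module.subspace fun_scale G"
    and "G \<subseteq> sph_harmonics L"
    and "c > 0"
  shows "\<exists>h0>0. \<exists>r>0. \<exists>C>0.
    \<forall>Y. node_set Y \<and> fill_distance Y \<le> h0 \<and> fill_distance Y / separation_distance Y \<le> c \<longrightarrow>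
      (\<forall>R\<ge>r. \<forall>\<delta>. \<delta> = R * fill_distance Y \<longrightarrow>
        (\<forall>y\<in>sphere 0 1.
          (\<exists>!a. is_minimizer G (weight \<phi> \<delta>) Y y a) \<and>
          lebesgue_constant G (weight \<phi> \<delta>) Y y \<le> C))"
proof -
  obtain t0 where t0: "t0 \<in> {0..1/2}" "\<And>t. t \<in> {0..1/2} \<Longrightarrow> \<phi> t0 \<le> \<phi> t"
    using continuous_attains_inf[of "{0..1/2}" \<phi>] continuous_on_subset[OF assms(2)] by force
  define m where "m = \<phi> t0"
  have m: "m > 0" "\<And>t. 0 \<le> t \<Longrightarrow> t \<le> 1/2 \<Longrightarrow> m \<le> \<phi> t"
    using t0 assms(4) by (auto simp: m_def)
  obtain t1 where t1: "t1 \<in> {0..1}" "\<And>t. t \<in> {0..1} \<Longrightarrow> \<phi> t \<le> \<phi> t1"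
    using continuous_attains_sup[of "{0..1}" \<phi>] continuous_on_subset[OF assms(2)] by force
  define \<Phi> where "\<Phi> = \<phi> t1"
  have \<Phi>: "\<phi> t \<le> \<Phi>" if "0 \<le> t" for t
    using that t1 assms(3,5) by (cases "t \<le> 1") (auto simp: \<Phi>_def)
  have "\<Phi> > 0" using m(1) m(2)[of 0] \<Phi>[of 0] by simp
  obtain \<kappa> Cg where \<kappa>: "\<kappa> > 0" and Cg: "Cg > 0"
    and cap: "\<forall>g\<in>(sph_harmonics L :: (real^'n \<Rightarrow> 'k) set). \<forall>y\<in>sphere 0 1. \<forall>\<rho>. 0 < \<rho> \<longrightarrow> \<rho> \<le> 1 \<longrightarrow>
      (\<exists>x\<in>sphere 0 1. sphere 0 1 \<inter> cball x (\<kappa> * \<rho>) \<subseteq> cball y \<rho> \<and>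
        (\<forall>z\<in>sphere 0 1 \<inter> cball x (\<kappa> * \<rho>). norm (g y) \<le> Cg * norm (g z)))"
    using sph_harmonics_cap_lower_bound[of L, where 'n = 'n and 'k = 'k]
    by (elim exE conjE) (rule that)
  obtain N where N: "\<forall>Y x y h q s. finite Y \<longrightarrow> Y \<subseteq> sphere (0::real^'n) 1 \<longrightarrow>
      (\<forall>z\<in>sphere 0 1. \<exists>v\<in>Y. dist z v \<le> h) \<longrightarrow> q > 0 \<longrightarrow>
      (\<forall>v\<in>Y. \<forall>z\<in>Y. v \<noteq> z \<longrightarrow> q \<le> dist v z) \<longrightarrow> h \<le> c * q \<longrightarrow>
      x \<in> sphere 0 1 \<longrightarrow> s > 0 \<longrightarrow> 2 * h \<le> s \<longrightarrow>
      card (Y \<inter> cball y (4 / \<kappa> * s)) \<le> N * card (Y \<inter> cball x s)"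
    using card_nodes_comparable_caps[OF assms(1), of c "4 / \<kappa>"] by (elim exE) (rule that)
  \<comment> \<open>The root is the bound obtained below; the summand 1 ensures positivity even if
    \<open>N\<close> is 0.\<close>
  define C where "C = sqrt (\<Phi> * N * Cg\<^sup>2 / m) + 1"
  have main: "(\<exists>!a. is_minimizer G (weight \<phi> \<delta>) Y y a) \<and> lebesgue_constant G (weight \<phi> \<delta>) Y y \<le> C"
    if Y: "node_set Y" and h0: "fill_distance Y \<le> \<kappa> / 2"
      and unif: "fill_distance Y / separation_distance Y \<le> c"
      and R: "R \<ge> 8 / \<kappa>" and \<delta>: "\<delta> = R * fill_distance Y" and y: "y \<in> sphere 0 1"
    for Y R \<delta> y
  proof -
    define h where "h = fill_distance Y"
    define q where "q = separation_distance Y"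
    note nodes = node_set_bounds[OF assms(1) Y, folded h_def q_def]
    have finY: "finite Y" and Y_sphere: "Y \<subseteq> sphere 0 1" using Y by (auto simp: node_set_def)
    have hq: "h \<le> c * q" using unif nodes(2) by (simp add: h_def q_def pos_divide_le_eq)
    have "R > 0" using R \<kappa> by (meson divide_pos_pos less_le_trans zero_less_numeral)
    then have "\<delta> > 0" using \<delta> nodes(1) by (simp add: h_def)
    \<comment> \<open>Chordal distance \<open>\<delta> / 4\<close> means arc at most
      \<open>\<delta> / 2\<close>, where \<open>\<phi>\<close> is at least \<open>m\<close>; the cap
      lemma needs radius at most 1.\<close>
    define \<rho> where "\<rho> = min 1 (\<delta> / 4)"
    have \<rho>: "0 < \<rho>" "\<rho> \<le> 1" "\<rho> \<le> \<delta> / 4" using \<open>\<delta> > 0\<close> by (auto simp: \<rho>_def)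
    define s where "s = \<kappa> * \<rho>"
    have s: "s > 0" using \<kappa> \<rho> by (simp add: s_def)
    \<comment> \<open>The two cases of \<open>\<rho>\<close> dictate the thresholds:
      \<open>h \<le> \<kappa> / 2\<close> serves \<open>\<rho> = 1\<close>, and
      \<open>R \<ge> 8 / \<kappa>\<close> serves \<open>\<rho> = \<delta> / 4\<close>.\<close>
    have hs: "2 * h \<le> s"
    proof -
      have "2 * h \<le> \<kappa> * 1" using h0 by (simp add: h_def)
      moreover have "8 / \<kappa> * h * \<kappa> \<le> R * h * \<kappa>"
        using R nodes(1) \<kappa> by (intro mult_right_mono) auto
      then have "2 * h \<le> \<kappa> * (\<delta> / 4)" using \<kappa> by (simp add: \<delta> h_def algebra_simps)
      ultimately show ?thesis unfolding s_def \<rho>_def min_def by auto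
    qed
    let ?w = "weight \<phi> \<delta>"
    let ?A = "active ?w Y y"
    have gc_nonneg: "0 \<le> gc_dist z y / \<delta>" if "z \<in> Y" for z
      using gc_dist_bounds(1)[of z y] that Y_sphere y \<open>\<delta> > 0\<close> by auto
    \<comment> \<open>The radius is \<open>4 * \<rho>\<close>, the minimum of 4 and
      \<open>\<delta>\<close>; in the first case the ball contains the whole sphere, of diameter
      2.\<close>
    have active_near: "?A \<subseteq> Y \<inter> cball y (4 / \<kappa> * s)"
    proof
      fix z assume "z \<in> ?A"
      then have z: "z \<in> Y" "\<phi> (gc_dist z y / \<delta>) > 0" by (auto simp: active_def weight_def)
      then have "gc_dist z y / \<delta> < 1" using assms(5) by (metis less_irrefl not_less)
      then have "gc_dist z y < \<delta>" using \<open>\<delta> > 0\<close> by simp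
      moreover have "dist y z \<le> gc_dist z y"
        using gc_dist_bounds(3)[of z y] z Y_sphere y by (auto simp: dist_commute)
      moreover have "dist y z \<le> norm y + norm z" by (simp add: dist_norm norm_triangle_ineq4)
      moreover have "norm y = 1" "norm z = 1" using y z(1) Y_sphere by auto
      ultimately have "dist y z \<le> 4 * \<rho>" by (auto simp: \<rho>_def min_def)
      then show "z \<in> Y \<inter> cball y (4 / \<kappa> * s)" using z(1) \<kappa> by (simp add: s_def)
    qed
    have cap_active: "z \<in> ?A \<and> m \<le> ?w z y" if "z \<in> Y" "z \<in> cball y \<rho>" for z
    proof -
      have "gc_dist z y \<le> 2 * dist z y" using gc_dist_bounds(4) that(1) Y_sphere y by blast
      then have "gc_dist z y / \<delta> \<le> 1 / 2"
        using that(2) \<rho>(3) \<open>\<delta> > 0\<close> by (simp add: dist_commute field_simps)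
      then have "m \<le> ?w z y" unfolding weight_def using m(2) gc_nonneg[OF that(1)] by blast
      then show ?thesis using that(1) m(1) by (auto simp: active_def)
    qed
    have cap_nodes: "\<exists>S\<subseteq>?A. S \<noteq> {} \<and> card ?A \<le> N * card S \<and>
        (\<forall>z\<in>S. m \<le> ?w z y \<and> norm (g y) \<le> Cg * norm (g z))" if g: "g \<in> G" for g
    proof -
      obtain x where x: "x \<in> sphere 0 1" "sphere 0 1 \<inter> cball x s \<subseteq> cball y \<rho>"
        and gx: "\<And>z. z \<in> sphere 0 1 \<inter> cball x s \<Longrightarrow> norm (g y) \<le> Cg * norm (g z)"
        using cap[THEN bspec, THEN bspec, THEN spec, of g y \<rho>] g assms(7) y \<rho>
        unfolding s_def by blast
      have "card ?A \<le> card (Y \<inter> cball y (4 / \<kappa> * s))"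
        by (rule card_mono[OF _ active_near]) (use finY in simp)
      also have "\<dots> \<le> N * card (Y \<inter> cball x s)"
      proof -
        have "\<forall>z\<in>sphere 0 1. \<exists>v\<in>Y. dist z v \<le> h" "\<forall>v\<in>Y. \<forall>z\<in>Y. v \<noteq> z \<longrightarrow> q \<le> dist v z"
          using nodes(3,4) by blast+
        then show ?thesis
          using N[THEN spec[of _ Y], THEN spec[of _ x], THEN spec[of _ y], THEN spec[of _ h],
              THEN spec[of _ q], THEN spec[of _ s]] finY Y_sphere nodes(2) hq x(1) s hs by blast
      qed
      finally have "card ?A \<le> N * card (Y \<inter> cball x s)" .
      moreover have "Y \<inter> cball x s \<noteq> {}"
      proof -
        obtain z where "z \<in> Y" "dist x z \<le> h" using nodes(3)[OF x(1)] by blast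
        then show ?thesis using hs nodes(1) by auto
      qed
      moreover have "z \<in> ?A \<and> m \<le> ?w z y \<and> norm (g y) \<le> Cg * norm (g z)" if "z \<in> Y \<inter> cball x s" for z
        using cap_active gx that x(2) Y_sphere by blast
      ultimately show ?thesis by (intro exI[of _ "Y \<inter> cball x s"]) blast
    qed
    have finA: "finite ?A" using finY by (simp add: active_def)
    define n where "n = card ?A"
    \<comment> \<open>The zero function already yields a nonempty set of active nodes.\<close>
    have "n > 0"
    proof -
      have "0 \<in> G"
        by (rule module.subspace_0[OF module_iff_vector_space[THEN iffD2, OF vector_space_fun_scale] assms(6)])
      from cap_nodes[OF this] have "?A \<noteq> {}" by blast
      then show ?thesis using finA by (simp add: n_def card_gt_0_iff)
    qed
    \<comment> \<open>The factor \<open>1 / n\<close> cancels against the weight sum, which is at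
      most \<open>n * \<Phi>\<close>, so the final bound is independent of the number of
      nodes.\<close>
    define B where "B = N * Cg\<^sup>2 / (m * n)"
    have "(norm (g y))\<^sup>2 \<le> B * (\<Sum>z\<in>?A. ?w z y * (norm (g z))\<^sup>2)" if g: "g \<in> G" for g
    proof -
      obtain S where S: "S \<subseteq> ?A" "card ?A \<le> N * card S"
        and gS: "\<And>z. z \<in> S \<Longrightarrow> m \<le> ?w z y \<and> norm (g y) \<le> Cg * norm (g z)"
        using cap_nodes[OF g] by blast
      have "real n \<le> real (N * card S)" unfolding n_def using S(2) by (rule of_nat_mono)
      then have "real n * (m * (norm (g y))\<^sup>2) \<le> real (N * card S) * (m * (norm (g y))\<^sup>2)"
        using m(1) by (intro mult_right_mono) auto
      also have "\<dots> = N * (\<Sum>z\<in>S. m * (norm (g y))\<^sup>2)" by simp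
      also have "(\<Sum>z\<in>S. m * (norm (g y))\<^sup>2) \<le> (\<Sum>z\<in>S. ?w z y * (Cg * norm (g z))\<^sup>2)"
        using gS m(1) by (intro sum_mono mult_mono power_mono) (auto intro: order_trans[OF less_imp_le])
      also have "\<dots> \<le> (\<Sum>z\<in>?A. ?w z y * (Cg * norm (g z))\<^sup>2)"
        using S(1) finA by (intro sum_mono2) (auto simp: active_def)
      also have "\<dots> = Cg\<^sup>2 * (\<Sum>z\<in>?A. ?w z y * (norm (g z))\<^sup>2)"
        by (simp add: sum_distrib_left power_mult_distrib mult_ac)
      finally have "real n * (m * (norm (g y))\<^sup>2) \<le> N * (Cg\<^sup>2 * (\<Sum>z\<in>?A. ?w z y * (norm (g z))\<^sup>2))"
        by (simp add: mult_left_mono)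
      then have "(m * n) * (norm (g y))\<^sup>2 \<le> N * Cg\<^sup>2 * (\<Sum>z\<in>?A. ?w z y * (norm (g z))\<^sup>2)"
        by (simp add: mult_ac)
      then show ?thesis using m(1) \<open>n > 0\<close>
        by (simp add: B_def pos_le_divide_eq mult.commute)
    qed
    moreover have "B \<ge> 0" using m(1) by (simp add: B_def)
    ultimately have lebesgue: "\<exists>!a. is_minimizer G ?w Y y a"
        "lebesgue_constant G ?w Y y \<le> sqrt ((\<Sum>z\<in>?A. ?w z y) * B)"
      using lebesgue_constant_le_sqrt[OF assms(6) finY] by blast+
    have "(\<Sum>z\<in>?A. ?w z y) \<le> of_nat (card ?A) * \<Phi>"
    proof (rule sum_bounded_above)
      fix z assume "z \<in> ?A"
      then show "?w z y \<le> \<Phi>" unfolding weight_def using \<Phi> gc_nonneg by (simp add: active_def)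
    qed
    then have "(\<Sum>z\<in>?A. ?w z y) * B \<le> n * \<Phi> * B"
      using \<open>B \<ge> 0\<close> by (intro mult_right_mono) (simp_all add: n_def)
    also have "\<dots> = \<Phi> * N * Cg\<^sup>2 / m" using \<open>n > 0\<close> by (simp add: B_def)
    finally have "sqrt ((\<Sum>z\<in>?A. ?w z y) * B) \<le> C"
      unfolding C_def by (meson add_increasing2 real_sqrt_le_mono zero_le_one)
    with lebesgue show ?thesis by linarith
  qed
  show ?thesis
  proof (rule exI[of _ "\<kappa> / 2"], rule conjI)
    show "\<exists>r>0. \<exists>C>0. \<forall>Y. node_set Y \<and> fill_distance Y \<le> \<kappa> / 2 \<and>
        fill_distance Y / separation_distance Y \<le> c \<longrightarrow>
      (\<forall>R\<ge>r. \<forall>\<delta>. \<delta> = R * fill_distance Y \<longrightarrow>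
        (\<forall>y\<in>sphere 0 1. (\<exists>!a. is_minimizer G (weight \<phi> \<delta>) Y y a) \<and>
          lebesgue_constant G (weight \<phi> \<delta>) Y y \<le> C))"
    proof (rule exI[of _ "8 / \<kappa>"], rule conjI, use \<kappa> in simp, rule exI[of _ C], rule conjI)
      show "C > 0" using m(1) \<open>\<Phi> > 0\<close> by (simp add: C_def add_nonneg_pos)
    qed (use main in blast)
  qed (use \<kappa> in simp)
qed

end
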